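(* Let $(A,\cdot,\alpha)$ be a finite-dimensional regular Hom-pre-Lie algebra and let $r\in A\otimes A$ be a Hom-$\mathfrak s$-matrix in it. Let $\varphi^*:A\to A\otimes A$ be defined by $$\varphi^*(x)=(L_x^{-2}\otimes\alpha+\alpha\otimes\mathrm{ad}_x^{-2})r,\qquad x\in A,$$ let $\circ:A^*\otimes A^*\to A^*$ be the dual of $\varphi^*$, i.e. $\langle x,\xi\circ\eta\rangle=\langle\varphi^*(x),\xi\otimes\eta\rangle$, and let $\psi^*:A^*\to A^*\otimes A^*$ be the dual of the multiplication $\cdot$ of $A$, i.e. $\langle\psi^*(\xi),x\otimes y\rangle=\langle\xi,x\cdot y\rangle$. Then $(A,A^*,\varphi^*,\psi^* )$ is a Hom-pre-Lie bialgebra (where $A^*$ carries the product $\circ$ and the twisting map $(\alpha^{-1})^*$).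
   Context: All vector spaces are finite-dimensional over a field; $\mathfrak{gl}(V)$ is the space of linear endomorphisms of $V$; for a linear map $f$, $f^*$ is the usual transpose, and $(V\otimes V)^*=V^*\otimes V^*$. Hom-pre-Lie algebra: $(A,\cdot,\alpha)$ with $\cdot$ bilinear, $\alpha\in\mathfrak{gl}(A)$, $\alpha(x\cdot y)=\alpha(x)\cdot\alpha(y)$ and $(x\cdot y)\cdot\alpha(z)-\alpha(x)\cdot(y\cdot z)=(y\cdot x)\cdot\alpha(z)-\alpha(y)\cdot(x\cdot z)$; regular means $\alpha$ invertible. Put $[x,y]=x\cdot y-y\cdot x$; $A^C=(A,[\cdot,\cdot],\alpha)$ is the sub-adjacent Hom-Lie algebra. $L^{-2}_xy=\alpha^{-2}(x)\cdot y$, $\mathrm{ad}^{-2}_xy=[\alpha^{-2}(x),y]$. Hom-$\mathfrak s$-matrix: for $r=\sum_i x_i\otimes y_i\in A\otimes A$ let $r^\sharp:A^*\to A$ be $\langle r^\sharp(\xi),\eta\rangle=\langle r,\xi\otimes\eta\rangle$, and $$[[r,r]]=[r_{12},r_{23}]-r_{13}\cdot r_{12}+r_{13}\cdot r_{23}:=\sum_{i,j}\Big(\alpha(x_i)\otimes[y_i,x_j]\otimes\alpha(y_j)-x_i\cdot x_j\otimes\alpha(y_j)\otimes\alpha(y_i)+\alpha(x_i)\otimes\alpha(x_j)\otimes y_i\cdot y_j\Big)\in A^{\otimes 3}.$$ $r$ is a Hom-$\mathfrak s$-matrix if $r$ is symmetric, $r^\sharp\circ(\alpha^{-1})^*=\alpha\circ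 r^\sharp$, and $[[r,r]]=0$. 1-cocycle of a Hom-Lie algebra $(\mathfrak g,[\cdot,\cdot],\phi)$ associated to a representation $\rho:\mathfrak g\to\mathfrak{gl}(V)$: linear $\delta:\mathfrak g\to V$ with $\delta([x,y])=\rho(\phi(x))\delta(y)-\rho(\phi(y))\delta(x)$. Hom-pre-Lie bialgebra $(A,A^*,\varphi^*,\psi^* )$: $(A,\cdot,\alpha)$ and $(A^*,\circ,(\alpha^{-1})^* )$ are Hom-pre-Lie algebras, $\varphi^*$, $\psi^*$ are the duals of $\circ$, $\cdot$ respectively, and, writing $\{\xi,\eta\}=\xi\circ\eta-\eta\circ\xi$: (a) $\varphi^*$ is a 1-cocycle of $A^C$ associated to the representation $x\mapsto L^{-2}_x\otimes\alpha+\alpha\otimes\mathrm{ad}^{-2}_x$ on $A\otimes A$; (b) $\psi^*$ is a 1-cocycle of $(A^* )^C=(A^*,\{\cdot,\cdot\},(\alpha^{-1})^* )$ associated to the representation $\xi\mapsto\mathcal L^{-2}_\xi\otimes(\alpha^{-1})^*+(\alpha^{-1})^*\otimes\mathfrak{ad}^{-2}_\xi$ on $A^*\otimes A^*$, where $\mathcal L^{-2}_\xi\eta=(\alpha^2)^*(\xi)\circ\eta$ and $\mathfrak{ad}^{-2}_\xi\eta=\{(\alpha^2)^*(\xi),\eta\}$. *)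

theory Defs
  imports Complex_Main "HOL-Library.Function_Algebras"
begin

text \<open>
  A vector space is a linear subspace \<open>vecs V\<close> of an ambient type carrying the scalar
  multiplication \<open>smul V\<close>; the addition is the one of the ambient type.  In this way a space, its
  dual and its tensor powers are objects of the same kind.
\<close>

record ('k, 'v) vspace =
  vecs :: "'v set"
  smul :: "'k \<Rightarrow> 'v \<Rightarrow> 'v"

locale fin_dim_space =
  fixes V :: "('k::field, 'v::ab_group_add) vspace"
  assumes vector_space_smul: "vector_space (smul V)"
    and subspace_vecs: "module.subspace (smul V) (vecs V)"
    and finite_dim: "\<exists>B. finite B \<and> vecs V = module.span (smul V) B"

definition linear_on ::
  "('k::field, 'v::ab_group_add) vspace \<Rightarrow> ('k, 'w::ab_group_add) vspace \<Rightarrow> ('v \<Rightarrow> 'w) \<Rightarrow> bool" where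
  "linear_on V W f \<longleftrightarrow>
     (\<forall>x\<in>vecs V. f x \<in> vecs W) \<and>
     (\<forall>x\<in>vecs V. \<forall>y\<in>vecs V. f (x + y) = f x + f y) \<and>
     (\<forall>c. \<forall>x\<in>vecs V. f (smul V c x) = smul W c (f x))"

definition bilinear_on ::
  "('k::field, 'v::ab_group_add) vspace \<Rightarrow> ('k, 'w::ab_group_add) vspace \<Rightarrow>
   ('k, 'u::ab_group_add) vspace \<Rightarrow> ('v \<Rightarrow> 'w \<Rightarrow> 'u) \<Rightarrow> bool" where
  "bilinear_on V W U b \<longleftrightarrow>
     (\<forall>x\<in>vecs V. linear_on W U (b x)) \<and> (\<forall>y\<in>vecs W. linear_on V U (\<lambda>x. b x y))"

definition scalars :: "('k::field, 'k) vspace" where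
  "scalars = \<lparr>vecs = UNIV, smul = (*)\<rparr>"

definition fun_smul :: "'k::field \<Rightarrow> ('x \<Rightarrow> 'k) \<Rightarrow> 'x \<Rightarrow> 'k" where
  "fun_smul c f = (\<lambda>x. c * f x)"

text \<open>Functionals are normalised to vanish outside \<open>vecs V\<close>, so that equality in the dual space is
  equality of functions.\<close>

definition dual :: "('k::field, 'v::ab_group_add) vspace \<Rightarrow> ('k, 'v \<Rightarrow> 'k) vspace" where
  "dual V = \<lparr>vecs = {\<xi>. linear_on V scalars \<xi> \<and> (\<forall>x. x \<notin> vecs V \<longrightarrow> \<xi> x = 0)},
             smul = fun_smul\<rparr>"

definition transp ::
  "('k::field, 'v::ab_group_add) vspace \<Rightarrow> ('v \<Rightarrow> 'w) \<Rightarrow> ('w \<Rightarrow> 'k) \<Rightarrow> 'v \<Rightarrow> 'k" where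
  "transp V f \<xi> = (\<lambda>x. if x \<in> vecs V then \<xi> (f x) else 0)"

text \<open>The canonical map from a space to its bidual.\<close>

definition bidual_ev :: "('k::field, 'v::ab_group_add) vspace \<Rightarrow> 'v \<Rightarrow> ('v \<Rightarrow> 'k) \<Rightarrow> 'k" where
  "bidual_ev V x = (\<lambda>\<xi>. if \<xi> \<in> vecs (dual V) then \<xi> x else 0)"

text \<open>
  The tensor product is realised as the span of the pure tensors inside the bilinear forms on the
  product of the two dual spaces, \<open>x \<otimes> y\<close> being the form \<open>(\<xi>, \<eta>) \<mapsto> \<xi> x * \<eta> y\<close>.  Hence the pairing
  of a tensor \<open>T\<close> with \<open>\<xi> \<otimes> \<eta>\<close> is the value \<open>T (\<xi>, \<eta>)\<close>.
\<close>

definition ptens ::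
  "('k::field, 'v::ab_group_add) vspace \<Rightarrow> ('k, 'w::ab_group_add) vspace \<Rightarrow> 'v \<Rightarrow> 'w \<Rightarrow>
   ('v \<Rightarrow> 'k) \<times> ('w \<Rightarrow> 'k) \<Rightarrow> 'k" where
  "ptens V W x y =
     (\<lambda>(\<xi>, \<eta>). if \<xi> \<in> vecs (dual V) \<and> \<eta> \<in> vecs (dual W) then \<xi> x * \<eta> y else 0)"

definition tensor ::
  "('k::field, 'v::ab_group_add) vspace \<Rightarrow> ('k, 'w::ab_group_add) vspace \<Rightarrow>
   ('k, ('v \<Rightarrow> 'k) \<times> ('w \<Rightarrow> 'k) \<Rightarrow> 'k) vspace" where
  "tensor V W =
     \<lparr>vecs = module.span fun_smul {ptens V W x y | x y. x \<in> vecs V \<and> y \<in> vecs W},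
      smul = fun_smul\<rparr>"

text \<open>The endomorphism \<open>f \<otimes> g\<close> of \<open>V \<otimes> V\<close>, the flip of the two factors, and the pure tensors of the
  third tensor power \<open>(V \<otimes> V) \<otimes> V\<close>; see \<open>tens_map_ptens\<close> and \<open>flip_ptens\<close> below for their
  values on pure tensors.\<close>

definition tens_map ::
  "('k::field, 'v::ab_group_add) vspace \<Rightarrow> ('v \<Rightarrow> 'v) \<Rightarrow> ('v \<Rightarrow> 'v) \<Rightarrow>
   (('v \<Rightarrow> 'k) \<times> ('v \<Rightarrow> 'k) \<Rightarrow> 'k) \<Rightarrow> ('v \<Rightarrow> 'k) \<times> ('v \<Rightarrow> 'k) \<Rightarrow> 'k" where
  "tens_map V f g T =
     (\<lambda>(\<xi>, \<eta>). if \<xi> \<in> vecs (dual V) \<and> \<eta> \<in> vecs (dual V)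
               then T (transp V f \<xi>, transp V g \<eta>) else 0)"

definition flip :: "('x \<times> 'x \<Rightarrow> 'k) \<Rightarrow> 'x \<times> 'x \<Rightarrow> 'k" where
  "flip T = (\<lambda>(\<xi>, \<eta>). T (\<eta>, \<xi>))"

definition ptens3 ::
  "('k::field, 'v::ab_group_add) vspace \<Rightarrow> 'v \<Rightarrow> 'v \<Rightarrow> 'v \<Rightarrow>
   ((('v \<Rightarrow> 'k) \<times> ('v \<Rightarrow> 'k) \<Rightarrow> 'k) \<Rightarrow> 'k) \<times> ('v \<Rightarrow> 'k) \<Rightarrow> 'k" where
  "ptens3 V x y z = ptens (tensor V V) V (ptens V V x y) z"

locale hom_pre_lie = fin_dim_space A
  for A :: "('k::field, 'a::ab_group_add) vspace" +
  fixes m :: "'a \<Rightarrow> 'a \<Rightarrow> 'a" and \<alpha> :: "'a \<Rightarrow> 'a"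
  assumes mult_bilinear: "bilinear_on A A A m"
    and twist_linear: "linear_on A A \<alpha>"
    and twist_mult: "\<lbrakk>x \<in> vecs A; y \<in> vecs A\<rbrakk> \<Longrightarrow> \<alpha> (m x y) = m (\<alpha> x) (\<alpha> y)"
    and hom_pre_lie_identity: "\<lbrakk>x \<in> vecs A; y \<in> vecs A; z \<in> vecs A\<rbrakk> \<Longrightarrow>
      m (m x y) (\<alpha> z) - m (\<alpha> x) (m y z) = m (m y x) (\<alpha> z) - m (\<alpha> y) (m x z)"

locale regular_hom_pre_lie = hom_pre_lie +
  assumes twist_bij: "bij_betw \<alpha> (vecs A) (vecs A)"

definition commutator :: "('a::ab_group_add \<Rightarrow> 'a \<Rightarrow> 'a) \<Rightarrow> 'a \<Rightarrow> 'a \<Rightarrow> 'a" where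
  "commutator m x y = m x y - m y x"

definition twist_inv :: "('k, 'a) vspace \<Rightarrow> ('a \<Rightarrow> 'a) \<Rightarrow> 'a \<Rightarrow> 'a" where
  "twist_inv A \<alpha> = inv_into (vecs A) \<alpha>"

text \<open>
  \<open>L_ad V m \<beta> \<gamma> x\<close> is the operator \<open>L\<^sub>x \<otimes> \<beta> + \<beta> \<otimes> ad\<^sub>x\<close> on \<open>V \<otimes> V\<close>, where \<open>L\<^sub>x y = m (\<gamma> x) y\<close> and
  \<open>ad\<^sub>x y = commutator m (\<gamma> x) y\<close>.  It is used with \<open>\<gamma>\<close> the inverse square of the twist \<open>\<beta>\<close>.
\<close>

definition L_ad ::
  "('k::field, 'v::ab_group_add) vspace \<Rightarrow> ('v \<Rightarrow> 'v \<Rightarrow> 'v) \<Rightarrow> ('v \<Rightarrow> 'v) \<Rightarrow> ('v \<Rightarrow> 'v) \<Rightarrow> 'v \<Rightarrow>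
   (('v \<Rightarrow> 'k) \<times> ('v \<Rightarrow> 'k) \<Rightarrow> 'k) \<Rightarrow> ('v \<Rightarrow> 'k) \<times> ('v \<Rightarrow> 'k) \<Rightarrow> 'k" where
  "L_ad V m \<beta> \<gamma> x T = tens_map V (m (\<gamma> x)) \<beta> T + tens_map V \<beta> (commutator m (\<gamma> x)) T"

definition sharp ::
  "('k::field, 'a::ab_group_add) vspace \<Rightarrow> (('a \<Rightarrow> 'k) \<times> ('a \<Rightarrow> 'k) \<Rightarrow> 'k) \<Rightarrow> ('a \<Rightarrow> 'k) \<Rightarrow> 'a" where
  "sharp A r \<xi> = (THE x. x \<in> vecs A \<and> (\<forall>\<eta>\<in>vecs (dual A). \<eta> x = r (\<xi>, \<eta>)))"

text \<open>The element \<open>[[r, r]]\<close> for \<open>r = (\<Sum>i<n. x i \<otimes> y i)\<close>.  It depends on \<open>r\<close> only, see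
  \<open>s_bracket_well_defined\<close> below.\<close>

definition s_bracket ::
  "('k::field, 'a::ab_group_add) vspace \<Rightarrow> ('a \<Rightarrow> 'a \<Rightarrow> 'a) \<Rightarrow> ('a \<Rightarrow> 'a) \<Rightarrow>
   nat \<Rightarrow> (nat \<Rightarrow> 'a) \<Rightarrow> (nat \<Rightarrow> 'a) \<Rightarrow>
   ((('a \<Rightarrow> 'k) \<times> ('a \<Rightarrow> 'k) \<Rightarrow> 'k) \<Rightarrow> 'k) \<times> ('a \<Rightarrow> 'k) \<Rightarrow> 'k" where
  "s_bracket A m \<alpha> n x y =
     (\<Sum>i<n. \<Sum>j<n.
        ptens3 A (\<alpha> (x i)) (commutator m (y i) (x j)) (\<alpha> (y j))
        - ptens3 A (m (x i) (x j)) (\<alpha> (y j)) (\<alpha> (y i))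
        + ptens3 A (\<alpha> (x i)) (\<alpha> (x j)) (m (y i) (y j)))"

definition hom_s_matrix ::
  "('k::field, 'a::ab_group_add) vspace \<Rightarrow> ('a \<Rightarrow> 'a \<Rightarrow> 'a) \<Rightarrow> ('a \<Rightarrow> 'a) \<Rightarrow>
   (('a \<Rightarrow> 'k) \<times> ('a \<Rightarrow> 'k) \<Rightarrow> 'k) \<Rightarrow> bool" where
  "hom_s_matrix A m \<alpha> r \<longleftrightarrow>
     r \<in> vecs (tensor A A) \<and>
     flip r = r \<and>
     (\<forall>\<xi>\<in>vecs (dual A). sharp A r (transp A (twist_inv A \<alpha>) \<xi>) = \<alpha> (sharp A r \<xi>)) \<and>
     (\<exists>n x y. (\<forall>i<n. x i \<in> vecs A \<and> y i \<in> vecs A) \<and>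
        r = (\<Sum>i<n. ptens A A (x i) (y i)) \<and> s_bracket A m \<alpha> n x y = 0)"

definition hom_lie_cocycle ::
  "('k::field, 'g::ab_group_add) vspace \<Rightarrow> ('g \<Rightarrow> 'g \<Rightarrow> 'g) \<Rightarrow> ('g \<Rightarrow> 'g) \<Rightarrow>
   ('k, 'v::ab_group_add) vspace \<Rightarrow> ('g \<Rightarrow> 'v \<Rightarrow> 'v) \<Rightarrow> ('g \<Rightarrow> 'v) \<Rightarrow> bool" where
  "hom_lie_cocycle G br \<phi> V \<rho> \<delta> \<longleftrightarrow>
     linear_on G V \<delta> \<and>
     (\<forall>x\<in>vecs G. \<forall>y\<in>vecs G. \<delta> (br x y) = \<rho> (\<phi> x) (\<delta> y) - \<rho> (\<phi> y) (\<delta> x))"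

text \<open>Duality between a map \<open>A \<rightarrow> A \<otimes> A\<close> and a product on the dual space, and between a product on
  \<open>A\<close> and a map \<open>A\<^sup>* \<rightarrow> A\<^sup>* \<otimes> A\<^sup>*\<close>.\<close>

definition dual_product ::
  "('k::field, 'a::ab_group_add) vspace \<Rightarrow> ('a \<Rightarrow> ('a \<Rightarrow> 'k) \<times> ('a \<Rightarrow> 'k) \<Rightarrow> 'k) \<Rightarrow>
   (('a \<Rightarrow> 'k) \<Rightarrow> ('a \<Rightarrow> 'k) \<Rightarrow> 'a \<Rightarrow> 'k) \<Rightarrow> bool" where
  "dual_product A \<phi> circ \<longleftrightarrow>
     (\<forall>\<xi>\<in>vecs (dual A). \<forall>\<eta>\<in>vecs (dual A).
        circ \<xi> \<eta> \<in> vecs (dual A) \<and> (\<forall>x\<in>vecs A. circ \<xi> \<eta> x = \<phi> x (\<xi>, \<eta>)))"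

definition dual_coproduct ::
  "('k::field, 'a::ab_group_add) vspace \<Rightarrow> ('a \<Rightarrow> 'a \<Rightarrow> 'a) \<Rightarrow>
   (('a \<Rightarrow> 'k) \<Rightarrow> (('a \<Rightarrow> 'k) \<Rightarrow> 'k) \<times> (('a \<Rightarrow> 'k) \<Rightarrow> 'k) \<Rightarrow> 'k) \<Rightarrow> bool" where
  "dual_coproduct A m \<psi> \<longleftrightarrow>
     (\<forall>\<xi>\<in>vecs (dual A). \<psi> \<xi> \<in> vecs (tensor (dual A) (dual A)) \<and>
        (\<forall>x\<in>vecs A. \<forall>y\<in>vecs A. \<psi> \<xi> (bidual_ev A x, bidual_ev A y) = \<xi> (m x y)))"

text \<open>Since the twist of the dual algebra is \<open>(\<alpha>\<inverse>)\<^sup>*\<close>, the algebra is required to be regular, and the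
  inverse square of the dual twist is \<open>(\<alpha>\<^sup>2)\<^sup>*\<close>.\<close>

definition hom_pre_lie_bialgebra ::
  "('k::field, 'a::ab_group_add) vspace \<Rightarrow> ('a \<Rightarrow> 'a \<Rightarrow> 'a) \<Rightarrow> ('a \<Rightarrow> 'a) \<Rightarrow>
   (('a \<Rightarrow> 'k) \<Rightarrow> ('a \<Rightarrow> 'k) \<Rightarrow> 'a \<Rightarrow> 'k) \<Rightarrow>
   ('a \<Rightarrow> ('a \<Rightarrow> 'k) \<times> ('a \<Rightarrow> 'k) \<Rightarrow> 'k) \<Rightarrow>
   (('a \<Rightarrow> 'k) \<Rightarrow> (('a \<Rightarrow> 'k) \<Rightarrow> 'k) \<times> (('a \<Rightarrow> 'k) \<Rightarrow> 'k) \<Rightarrow> 'k) \<Rightarrow> bool" where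
  "hom_pre_lie_bialgebra A m \<alpha> circ \<phi> \<psi> \<longleftrightarrow>
     regular_hom_pre_lie A m \<alpha> \<and>
     hom_pre_lie (dual A) circ (transp A (twist_inv A \<alpha>)) \<and>
     dual_product A \<phi> circ \<and>
     dual_coproduct A m \<psi> \<and>
     hom_lie_cocycle A (commutator m) \<alpha> (tensor A A)
       (L_ad A m \<alpha> (twist_inv A \<alpha> \<circ> twist_inv A \<alpha>)) \<phi> \<and>
     hom_lie_cocycle (dual A) (commutator circ) (transp A (twist_inv A \<alpha>))
       (tensor (dual A) (dual A))
       (L_ad (dual A) circ (transp A (twist_inv A \<alpha>)) (transp A (\<alpha> \<circ> \<alpha>))) \<psi>"


subsection \<open>The tensor constructions behave as intended\<close>

lemma vector_space_fun_smul: "vector_space (fun_smul :: 'k::field \<Rightarrow> ('x \<Rightarrow> 'k) \<Rightarrow> _)"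
  by unfold_locales (auto simp: fun_smul_def fun_eq_iff algebra_simps)

interpretation fs: vector_space "fun_smul :: 'k::field \<Rightarrow> ('x \<Rightarrow> 'k) \<Rightarrow> _"
  by (rule vector_space_fun_smul)

lemma sum_apply: "(\<Sum>i\<in>I. f i) x = (\<Sum>i\<in>I. f i x)"
  by (induction I rule: infinite_finite_induct) auto

lemma linear_onD:
  assumes "linear_on V W f"
  shows "x \<in> vecs V \<Longrightarrow> f x \<in> vecs W"
    and "x \<in> vecs V \<Longrightarrow> y \<in> vecs V \<Longrightarrow> f (x + y) = f x + f y"
    and "x \<in> vecs V \<Longrightarrow> f (smul V c x) = smul W c (f x)"
  using assms by (auto simp: linear_on_def)

lemma dualD:
  assumes "\<xi> \<in> vecs (dual V)"
  shows "x \<in> vecs V \<Longrightarrow> y \<in> vecs V \<Longrightarrow> \<xi> (x + y) = \<xi> x + \<xi> y"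
    and "x \<in> vecs V \<Longrightarrow> \<xi> (smul V c x) = c * \<xi> x"
    and "x \<notin> vecs V \<Longrightarrow> \<xi> x = 0"
  using assms by (auto simp: dual_def linear_on_def scalars_def)

lemma ptens_in_tensor: "x \<in> vecs V \<Longrightarrow> y \<in> vecs W \<Longrightarrow> ptens V W x y \<in> vecs (tensor V W)"
  by (auto simp: tensor_def intro: fs.span_base)

context fin_dim_space
begin

interpretation vs: vector_space "smul V" by (rule vector_space_smul)

lemma vecs_closed:
  shows "0 \<in> vecs V" and "x \<in> vecs V \<Longrightarrow> y \<in> vecs V \<Longrightarrow> x + y \<in> vecs V"
    and "x \<in> vecs V \<Longrightarrow> smul V c x \<in> vecs V"
    and "x \<in> vecs V \<Longrightarrow> y \<in> vecs V \<Longrightarrow> x - y \<in> vecs V"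
    and "(\<And>i. i \<in> I \<Longrightarrow> f i \<in> vecs V) \<Longrightarrow> (\<Sum>i\<in>I. f i) \<in> vecs V"
  using subspace_vecs
  by (auto simp: vs.subspace_0 vs.subspace_add vs.subspace_scale vs.subspace_diff vs.subspace_sum)

lemma transp_in_dual:
  assumes "linear_on V W f" and "\<xi> \<in> vecs (dual W)"
  shows "transp V f \<xi> \<in> vecs (dual V)"
proof -
  have "linear_on V scalars (transp V f \<xi>)"
    using assms(1) dualD[OF assms(2)]
    by (auto simp: linear_on_def transp_def scalars_def vecs_closed)
  then show ?thesis by (simp add: dual_def transp_def)
qed

lemma dual_basis:
  obtains B c where "finite B" and "B \<subseteq> vecs V" and "\<And>b. b \<in> B \<Longrightarrow> c b \<in> vecs (dual V)"
    and "\<And>x. x \<in> vecs V \<Longrightarrow> x = (\<Sum>b\<in>B. smul V (c b x) b)"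
    and "\<And>b d. b \<in> B \<Longrightarrow> d \<in> B \<Longrightarrow> c b d = (if b = d then 1 else 0)"
proof -
  obtain S where S: "finite S" "vecs V = vs.span S" using finite_dim by auto
  obtain B where B: "B \<subseteq> vecs V" "vs.independent B" "vecs V \<subseteq> vs.span B"
    using vs.maximal_independent_subset[of "vecs V"] by metis
  have fin: "finite B"
    using vs.independent_span_bound[OF S(1) B(2)] B(1) S(2) by auto
  have span: "vs.span B = vecs V"
    using B(1,3) vs.span_minimal[OF B(1) subspace_vecs] by auto
  define c where "c b x = (if x \<in> vecs V then vs.representation B x b else 0)" for b x
  have "c b \<in> vecs (dual V)" for b
    by (auto simp: dual_def linear_on_def scalars_def c_def vecs_closed
        vs.representation_add[OF B(2)] vs.representation_scale[OF B(2)] span)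
  moreover have "x = (\<Sum>b\<in>B. smul V (c b x) b)" if "x \<in> vecs V" for x
    using vs.sum_representation_eq[OF B(2), of x B] that fin by (simp add: c_def span)
  moreover have "c b d = (if b = d then 1 else 0)" if "b \<in> B" "d \<in> B" for b d
    using vs.representation_basis[OF B(2) that(2)] B(1) that by (auto simp: c_def)
  ultimately show ?thesis using that[of B c] fin B(1) by blast
qed

lemma linear_on_sum:
  assumes "linear_on V W f" and "vector_space (smul W)" and "\<And>i. i \<in> I \<Longrightarrow> g i \<in> vecs V"
  shows "f (\<Sum>i\<in>I. smul V (a i) (g i)) = (\<Sum>i\<in>I. smul W (a i) (f (g i)))"
proof -
  have z: "f 0 = 0"
    using linear_onD(2)[OF assms(1) vecs_closed(1) vecs_closed(1)] by simp
  show ?thesis using assms(3)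
    by (induction I rule: infinite_finite_induct)
      (simp_all add: z linear_onD[OF assms(1)] vecs_closed)
qed

end

lemma vector_space_scalars: "vector_space (smul scalars)"
  by unfold_locales (auto simp: scalars_def algebra_simps)

lemma dual_linear_on: "\<xi> \<in> vecs (dual V) \<Longrightarrow> linear_on V scalars \<xi>"
  by (simp add: dual_def)

lemma ptens_bilinear:
  assumes "fin_dim_space V" and "fin_dim_space W"
  shows "bilinear_on V W (tensor V W) (ptens V W)"
  by (auto simp: bilinear_on_def linear_on_def ptens_in_tensor)
    (auto simp: ptens_def fun_eq_iff tensor_def fun_smul_def dualD algebra_simps)

lemma tens_map_ptens:
  assumes "fin_dim_space V" and "linear_on V V f" and "linear_on V V g"
    and "x \<in> vecs V" and "y \<in> vecs V"
  shows "tens_map V f g (ptens V V x y) = ptens V V (f x) (g y)"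
  using fin_dim_space.transp_in_dual[OF assms(1)] assms(2-)
  by (auto simp: tens_map_def ptens_def fun_eq_iff transp_def[abs_def])

lemma tens_map_sum: "tens_map V f g (\<Sum>i\<in>I. T i) = (\<Sum>i\<in>I. tens_map V f g (T i))"
  by (auto simp: tens_map_def fun_eq_iff sum_apply)

lemma flip_ptens: "flip (ptens V V x y) = ptens V V y x"
  by (auto simp: flip_def ptens_def fun_eq_iff)

text \<open>Bilinear maps are evaluated through the tensor, which is the universal property.\<close>

lemma bilinear_through_tensor:
  fixes V :: "('k::field, 'v::ab_group_add) vspace" and W :: "('k, 'w::ab_group_add) vspace"
    and U :: "('k, 'u::ab_group_add) vspace" and n n' :: nat
  assumes "fin_dim_space V" and "fin_dim_space W" and U: "vector_space (smul U)"
    and b: "bilinear_on V W U b"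
    and xy: "\<And>i. i < n \<Longrightarrow> x i \<in> vecs V \<and> y i \<in> vecs W"
    and xy': "\<And>i. i < n' \<Longrightarrow> x' i \<in> vecs V \<and> y' i \<in> vecs W"
    and eq: "(\<Sum>i<n. ptens V W (x i) (y i)) = (\<Sum>i<n'. ptens V W (x' i) (y' i))"
  shows "(\<Sum>i<n. b (x i) (y i)) = (\<Sum>i<n'. b (x' i) (y' i))"
proof -
  interpret V: fin_dim_space V by fact
  interpret W: fin_dim_space W by fact
  interpret U: vector_space "smul U" by (rule U)
  obtain B c where B: "finite B" "B \<subseteq> vecs V" "\<And>b. b \<in> B \<Longrightarrow> c b \<in> vecs (dual V)"
    "\<And>x. x \<in> vecs V \<Longrightarrow> x = (\<Sum>b\<in>B. smul V (c b x) b)"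
    by (rule V.dual_basis) blast
  obtain D d where D: "finite D" "D \<subseteq> vecs W" "\<And>b. b \<in> D \<Longrightarrow> d b \<in> vecs (dual W)"
    "\<And>x. x \<in> vecs W \<Longrightarrow> x = (\<Sum>b\<in>D. smul W (d b x) b)"
    by (rule W.dual_basis) blast
  have one: "b u w = (\<Sum>p\<in>B. \<Sum>q\<in>D. smul U (ptens V W u w (c p, d q)) (b p q))"
    if u: "u \<in> vecs V" and w: "w \<in> vecs W" for u w
  proof -
    have "b u w = b (\<Sum>p\<in>B. smul V (c p u) p) w" using B(4)[OF u] by simp
    also have "\<dots> = (\<Sum>p\<in>B. smul U (c p u) (b p w))"
      using b w B(2) by (intro V.linear_on_sum[OF _ U]) (auto simp: bilinear_on_def)
    also have "\<dots> = (\<Sum>p\<in>B. \<Sum>q\<in>D. smul U (ptens V W u w (c p, d q)) (b p q))"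
    proof (rule sum.cong[OF refl])
      fix p assume p: "p \<in> B"
      have "b p w = b p (\<Sum>q\<in>D. smul W (d q w) q)" using D(4)[OF w] by simp
      also have "\<dots> = (\<Sum>q\<in>D. smul U (d q w) (b p q))"
        using b p D(2) B(2) by (intro W.linear_on_sum[OF _ U]) (auto simp: bilinear_on_def)
      finally show "smul U (c p u) (b p w) =
          (\<Sum>q\<in>D. smul U (ptens V W u w (c p, d q)) (b p q))"
        using p by (simp add: U.scale_sum_right ptens_def B(3) D(3))
    qed
    finally show ?thesis .
  qed
  have all: "(\<Sum>i<l. b (u i) (w i)) =
      (\<Sum>p\<in>B. \<Sum>q\<in>D. smul U ((\<Sum>i<l. ptens V W (u i) (w i)) (c p, d q)) (b p q))"
    if uw: "\<And>i. i < l \<Longrightarrow> u i \<in> vecs V \<and> w i \<in> vecs W" for l :: nat and u w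
  proof -
    have "(\<Sum>i<l. b (u i) (w i)) =
        (\<Sum>i<l. \<Sum>p\<in>B. \<Sum>q\<in>D. smul U (ptens V W (u i) (w i) (c p, d q)) (b p q))"
      using uw by (intro sum.cong) (auto intro: one)
    also have "\<dots> =
        (\<Sum>p\<in>B. \<Sum>i<l. \<Sum>q\<in>D. smul U (ptens V W (u i) (w i) (c p, d q)) (b p q))"
      by (rule sum.swap)
    also have "\<dots> =
        (\<Sum>p\<in>B. \<Sum>q\<in>D. \<Sum>i<l. smul U (ptens V W (u i) (w i) (c p, d q)) (b p q))"
      by (intro sum.cong refl sum.swap)
    finally show ?thesis by (simp add: sum_apply U.scale_sum_left)
  qed
  show ?thesis using all[where l=n and u=x and w=y, OF xy] all[where l=n' and u=x' and w=y', OF xy'] eq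
    by simp
qed

text \<open>Every bilinear product on \<open>A\<close> has a dual coproduct.\<close>

lemma dual_coproduct_exists:
  assumes "fin_dim_space A" and m: "bilinear_on A A A m"
  shows "\<exists>\<psi>. dual_coproduct A m \<psi>"
proof -
  interpret fin_dim_space A by fact
  obtain B c where B: "finite B" "B \<subseteq> vecs A" "\<And>b. b \<in> B \<Longrightarrow> c b \<in> vecs (dual A)"
    "\<And>x. x \<in> vecs A \<Longrightarrow> x = (\<Sum>b\<in>B. smul A (c b x) b)"
    by (rule dual_basis) blast
  define \<psi> where "\<psi> \<xi> = (\<Sum>p\<in>B. \<Sum>q\<in>B.
      fun_smul (\<xi> (m p q)) (ptens (dual A) (dual A) (c p) (c q)))" for \<xi> :: "'b \<Rightarrow> 'a"
  have "\<psi> \<xi> \<in> vecs (tensor (dual A) (dual A))" for \<xi>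
    using B(3) unfolding \<psi>_def tensor_def vspace.simps
    by (intro fs.span_sum fs.span_scale fs.span_base) blast
  moreover have "\<psi> \<xi> (bidual_ev A x, bidual_ev A y) = \<xi> (m x y)"
    if \<xi>: "\<xi> \<in> vecs (dual A)" and x: "x \<in> vecs A" and y: "y \<in> vecs A" for \<xi> x y
  proof -
    have B': "p \<in> vecs A" if "p \<in> B" for p using B(2) that by blast
    have ev: "bidual_ev A x \<in> vecs (dual (dual A))" if "x \<in> vecs A" for x
      using that
      by (auto simp: bidual_ev_def dual_def linear_on_def scalars_def fun_smul_def algebra_simps)
    have m1: "linear_on A scalars (\<lambda>u. \<xi> (m u w))" if "w \<in> vecs A" for w
      using m \<xi> that by (auto simp: bilinear_on_def linear_on_def dual_def scalars_def)
    have m2: "linear_on A scalars (\<lambda>w. \<xi> (m u w))" if "u \<in> vecs A" for u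
      using m \<xi> that by (auto simp: bilinear_on_def linear_on_def dual_def scalars_def)
    have "\<xi> (m x y) = \<xi> (m (\<Sum>p\<in>B. smul A (c p x) p) y)" using B(4)[OF x] by simp
    also have "\<dots> = (\<Sum>p\<in>B. c p x * \<xi> (m p y))"
      using linear_on_sum[OF m1[OF y] vector_space_scalars B', of B]
      by (simp add: scalars_def)
    also have "\<dots> = (\<Sum>p\<in>B. \<Sum>q\<in>B. \<xi> (m p q) * (c p x * c q y))"
    proof (rule sum.cong[OF refl])
      fix p assume p: "p \<in> B"
      have "\<xi> (m p y) = \<xi> (m p (\<Sum>q\<in>B. smul A (c q y) q))" using B(4)[OF y] by simp
      also have "\<dots> = (\<Sum>q\<in>B. c q y * \<xi> (m p q))"
        using linear_on_sum[OF m2[OF B'[OF p]] vector_space_scalars B', of B]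
        by (simp add: scalars_def)
      finally show "c p x * \<xi> (m p y) = (\<Sum>q\<in>B. \<xi> (m p q) * (c p x * c q y))"
        by (simp add: sum_distrib_left algebra_simps)
    qed
    moreover have "ptens (dual A) (dual A) (c p) (c q) (bidual_ev A x, bidual_ev A y) = c p x * c q y"
      if "p \<in> B" "q \<in> B" for p q
      using B(3) that by (simp add: ptens_def ev x y) (simp add: bidual_ev_def)
    ultimately show ?thesis by (simp add: \<psi>_def sum_apply fun_smul_def)
  qed
  ultimately show ?thesis unfolding dual_coproduct_def by blast
qed

lemma sharp_sum_ptens:
  fixes n :: nat
  assumes "fin_dim_space A" and xy: "\<And>i. i < n \<Longrightarrow> x i \<in> vecs A \<and> y i \<in> vecs A"
    and \<xi>: "\<xi> \<in> vecs (dual A)"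
  shows "sharp A (\<Sum>i<n. ptens A A (x i) (y i)) \<xi> = (\<Sum>i<n. smul A (\<xi> (x i)) (y i))"
proof -
  interpret fin_dim_space A by fact
  obtain B c where B: "finite B" "B \<subseteq> vecs A" "\<And>b. b \<in> B \<Longrightarrow> c b \<in> vecs (dual A)"
    "\<And>x. x \<in> vecs A \<Longrightarrow> x = (\<Sum>b\<in>B. smul A (c b x) b)"
    by (rule dual_basis) blast
  let ?s = "\<Sum>i<n. smul A (\<xi> (x i)) (y i)"
  have s: "?s \<in> vecs A" using xy by (auto intro!: vecs_closed)
  have ev: "\<eta> ?s = (\<Sum>i<n. ptens A A (x i) (y i)) (\<xi>, \<eta>)" if "\<eta> \<in> vecs (dual A)" for \<eta>
    using linear_on_sum[OF dual_linear_on[OF that] vector_space_scalars, of "{..<n}" y] xy that \<xi>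
    by (auto simp: sum_apply ptens_def scalars_def)
  show ?thesis unfolding sharp_def
  proof (rule the_equality)
    show "?s \<in> vecs A \<and> (\<forall>\<eta>\<in>vecs (dual A). \<eta> ?s = (\<Sum>i<n. ptens A A (x i) (y i)) (\<xi>, \<eta>))"
      using s ev by blast
  next
    fix z assume z: "z \<in> vecs A \<and> (\<forall>\<eta>\<in>vecs (dual A). \<eta> z = (\<Sum>i<n. ptens A A (x i) (y i)) (\<xi>, \<eta>))"
    then have "c b z = c b ?s" if "b \<in> B" for b using ev[of "c b"] B(3)[OF that] by simp
    then have "(\<Sum>b\<in>B. smul A (c b z) b) = (\<Sum>b\<in>B. smul A (c b ?s) b)" by simp
    then show "z = ?s" using B(4)[of z] B(4)[OF s] z by simp
  qed
qed

definition s_bracket_term where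
  "s_bracket_term A m \<alpha> u v x y =
     ptens3 A (\<alpha> u) (commutator m v x) (\<alpha> y) - ptens3 A (m u x) (\<alpha> y) (\<alpha> v)
     + ptens3 A (\<alpha> u) (\<alpha> x) (m v y)"

lemma ptens3_linear:
  assumes "fin_dim_space A" "x \<in> vecs A" "x' \<in> vecs A" "y \<in> vecs A" "y' \<in> vecs A"
    "z \<in> vecs A" "z' \<in> vecs A"
  shows "ptens3 A (x + x') y z = ptens3 A x y z + ptens3 A x' y z"
    and "ptens3 A x (y + y') z = ptens3 A x y z + ptens3 A x y' z"
    and "ptens3 A x y (z + z') = ptens3 A x y z + ptens3 A x y z'"
    and "ptens3 A (smul A c x) y z = fun_smul c (ptens3 A x y z)"
    and "ptens3 A x (smul A c y) z = fun_smul c (ptens3 A x y z)"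
    and "ptens3 A x y (smul A c z) = fun_smul c (ptens3 A x y z)"
proof -
  interpret fin_dim_space A by fact
  note pb = ptens_bilinear[OF assms(1) assms(1), unfolded bilinear_on_def]
  have p: "ptens A A (x + x') y = ptens A A x y + ptens A A x' y"
    "ptens A A x (y + y') = ptens A A x y + ptens A A x y'"
    "ptens A A (smul A c x) y = smul (tensor A A) c (ptens A A x y)"
    "ptens A A x (smul A c y) = smul (tensor A A) c (ptens A A x y)"
    using pb assms by (auto simp: linear_on_def)
  show "ptens3 A (x + x') y z = ptens3 A x y z + ptens3 A x' y z"
    "ptens3 A x (y + y') z = ptens3 A x y z + ptens3 A x y' z"
    "ptens3 A x y (z + z') = ptens3 A x y z + ptens3 A x y z'"
    "ptens3 A (smul A c x) y z = fun_smul c (ptens3 A x y z)"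
    "ptens3 A x (smul A c y) z = fun_smul c (ptens3 A x y z)"
    "ptens3 A x y (smul A c z) = fun_smul c (ptens3 A x y z)"
    unfolding ptens3_def p
    using assms ptens_in_tensor[of _ A _ A]
    by (auto simp: ptens_def[of "tensor A A"] fun_eq_iff fun_smul_def dualD algebra_simps)
qed

lemma s_bracket_well_defined:
  fixes A :: "('k::field, 'a::ab_group_add) vspace"
  assumes A: "fin_dim_space A" and m: "bilinear_on A A A m" and \<alpha>: "linear_on A A \<alpha>"
    and xy: "\<And>i. i < n \<Longrightarrow> x i \<in> vecs A \<and> y i \<in> vecs A"
    and xy': "\<And>i. i < n' \<Longrightarrow> x' i \<in> vecs A \<and> y' i \<in> vecs A"
    and eq: "(\<Sum>i<n. ptens A A (x i) (y i)) = (\<Sum>i<n'. ptens A A (x' i) (y' i))"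
  shows "s_bracket A m \<alpha> n x y = s_bracket A m \<alpha> n' x' y'"
proof -
  interpret fin_dim_space A by fact
  interpret vs: vector_space "smul A" by (rule vector_space_smul)
  let ?U = "\<lparr>vecs = UNIV, smul = fun_smul\<rparr> ::
    ('k, ((('a \<Rightarrow> 'k) \<times> ('a \<Rightarrow> 'k) \<Rightarrow> 'k) \<Rightarrow> 'k) \<times> ('a \<Rightarrow> 'k) \<Rightarrow> 'k) vspace"
  let ?t = "s_bracket_term A m \<alpha>"
  have U: "vector_space (smul ?U)" using vector_space_fun_smul by simp
  have mc: "m u v \<in> vecs A" if "u \<in> vecs A" "v \<in> vecs A" for u v
    using m that by (auto simp: bilinear_on_def linear_on_def)
  have ma: "m (u + u') v = m u v + m u' v" "m v (u + u') = m v u + m v u'"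
    if "u \<in> vecs A" "u' \<in> vecs A" "v \<in> vecs A" for u u' v
    using m that by (auto simp: bilinear_on_def linear_on_def)
  have ms: "m (smul A c u) v = smul A c (m u v)" "m v (smul A c u) = smul A c (m v u)"
    if "u \<in> vecs A" "v \<in> vecs A" for c u v
    using m that by (auto simp: bilinear_on_def linear_on_def)
  have cc: "commutator m u v \<in> vecs A" if "u \<in> vecs A" "v \<in> vecs A" for u v
    using mc that by (simp add: commutator_def vecs_closed)
  have ca: "commutator m (u + u') v = commutator m u v + commutator m u' v"
    "commutator m v (u + u') = commutator m v u + commutator m v u'"
    if "u \<in> vecs A" "u' \<in> vecs A" "v \<in> vecs A" for u u' v
    using that by (simp_all add: commutator_def ma)
  have cs: "commutator m (smul A c u) v = smul A c (commutator m u v)"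
    "commutator m v (smul A c u) = smul A c (commutator m v u)"
    if "u \<in> vecs A" "v \<in> vecs A" for c u v
    using that by (simp_all add: commutator_def ms vs.scale_right_diff_distrib)
  note clo = mc cc linear_onD[OF \<alpha>] ma ms ca cs vecs_closed ptens3_linear[OF A]
  have left: "bilinear_on A A ?U (\<lambda>u v. ?t u v p q)" if "p \<in> vecs A" "q \<in> vecs A" for p q
    using that
    by (auto simp: bilinear_on_def linear_on_def s_bracket_term_def clo
        fs.scale_right_diff_distrib fs.scale_right_distrib)
  have right: "bilinear_on A A ?U (?t u v)" if "u \<in> vecs A" "v \<in> vecs A" for u v
    using that
    by (auto simp: bilinear_on_def linear_on_def s_bracket_term_def clo
        fs.scale_right_diff_distrib fs.scale_right_distrib)
  have "(\<Sum>i<n. \<Sum>j<n. ?t (x i) (y i) (x j) (y j)) =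
      (\<Sum>i<n. \<Sum>j<n'. ?t (x i) (y i) (x' j) (y' j))"
    using xy bilinear_through_tensor[OF A A U right xy xy' eq] by (intro sum.cong[OF refl]) auto
  also have "\<dots> = (\<Sum>j<n'. \<Sum>i<n. ?t (x i) (y i) (x' j) (y' j))" by (rule sum.swap)
  also have "\<dots> = (\<Sum>j<n'. \<Sum>i<n'. ?t (x' i) (y' i) (x' j) (y' j))"
    using xy' bilinear_through_tensor[OF A A U left xy xy' eq] by (intro sum.cong[OF refl]) auto
  also have "\<dots> = (\<Sum>i<n'. \<Sum>j<n'. ?t (x' i) (y' i) (x' j) (y' j))" by (rule sum.swap)
  finally show ?thesis by (simp add: s_bracket_def s_bracket_term_def)
qed

end

theory Submission
  imports Defs
begin

text \<open>
  Write \<open>R = r\<^sup>\<sharp>\<close> and \<open>a = \<alpha>\<inverse>\<close>.  The symmetry of \<open>r\<close> and its compatibility with the twist give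
  \<open>\<langle>x, \<xi> \<circ> \<eta>\<rangle> = \<langle>\<xi>, a\<^sup>2x \<cdot> aR\<eta>\<rangle> + \<langle>\<eta>, [a\<^sup>2x, aR\<xi>]\<rangle>\<close>, and \<open>[[r, r]] = 0\<close> says exactly that
  \<open>R (\<xi> \<circ> \<eta>) = R\<xi> \<cdot> R\<eta>\<close>.  Substituting both formulas, the Hom-pre-Lie identity of \<open>\<circ>\<close> and
  the two cocycle conditions split into coefficients of the functionals involved.  Each coefficient is
  an instance of the Hom-pre-Lie identity of \<open>A\<close>, up to terms in which \<open>R\<close> is applied to a translated
  functional; these cancel by the symmetry of \<open>r\<close>.
\<close>

section \<open>Tensors, functionals and reflexivity of finite-dimensional spaces\<close>

lemma smul_dual [simp]: "smul (dual V) = fun_smul"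
  by (simp add: dual_def)

lemma smul_tensor [simp]: "smul (tensor V W) = fun_smul"
  by (simp add: tensor_def)

lemma fun_smul_apply: "fun_smul c f x = c * f x"
  by (simp add: fun_smul_def)

lemma subspace_tensor: "fs.subspace (vecs (tensor V W))"
  by (simp add: tensor_def)

text \<open>Pure tensors take the default value 0 at such pairs, and this passes to their span.
  Equality of tensors therefore needs checking only at pairs of genuine functionals.\<close>

lemma tensor_outside:
  assumes T: "T \<in> vecs (tensor V W)" and out: "\<not> (\<xi> \<in> vecs (dual V) \<and> \<eta> \<in> vecs (dual W))"
  shows "T (\<xi>, \<eta>) = 0"
proof -
  have "T \<in> fs.span {ptens V W x y | x y. x \<in> vecs V \<and> y \<in> vecs W}"
    using T by (simp add: tensor_def)
  then show ?thesis
    by (rule fs.span_induct) (use out in \<open>auto simp: fs.subspace_def fun_smul_def ptens_def\<close>)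
qed

text \<open>\<open>tens_map\<close> is linear in the tensor and sends pure tensors to pure tensors,
  so span induction applies.\<close>

lemma tens_map_in_tensor:
  assumes "fin_dim_space V" "linear_on V V f" "linear_on V V g" and T: "T \<in> vecs (tensor V V)"
  shows "tens_map V f g T \<in> vecs (tensor V V)"
proof -
  have "T \<in> fs.span {ptens V V x y | x y. x \<in> vecs V \<and> y \<in> vecs V}"
    using T by (simp add: tensor_def)
  then show ?thesis
  proof (rule fs.span_induct)
    have 0: "tens_map V f g 0 = 0"
      and add: "tens_map V f g (S + T) = tens_map V f g S + tens_map V f g T"
      and scale: "tens_map V f g (fun_smul k T) = fun_smul k (tens_map V f g T)" for S T k
      by (auto simp: tens_map_def fun_eq_iff fun_smul_def)
    show "fs.subspace {T. tens_map V f g T \<in> vecs (tensor V V)}"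
      using subspace_tensor[of V V] by (simp add: fs.subspace_def 0 add scale)
    fix T assume "T \<in> {ptens V V x y | x y. x \<in> vecs V \<and> y \<in> vecs V}"
    then show "tens_map V f g T \<in> vecs (tensor V V)"
      using assms(1-3)
      by (auto simp: tens_map_ptens intro!: ptens_in_tensor linear_onD(1)[OF assms(2)]
          linear_onD(1)[OF assms(3)])
  qed
qed

lemma L_ad_in_tensor:
  assumes "fin_dim_space V" "linear_on V V \<beta>" "linear_on V V (m (\<gamma> x))"
    "linear_on V V (commutator m (\<gamma> x))" "T \<in> vecs (tensor V V)"
  shows "L_ad V m \<beta> \<gamma> x T \<in> vecs (tensor V V)"
  unfolding L_ad_def
  by (intro fs.subspace_add[OF subspace_tensor] tens_map_in_tensor assms)

context fin_dim_space
begin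

lemma transp_apply [simp]: "x \<in> vecs V \<Longrightarrow> transp V f \<xi> x = \<xi> (f x)"
  by (simp add: transp_def)

lemma dual_eqI:
  assumes "\<xi> \<in> vecs (dual V)" "\<eta> \<in> vecs (dual V)" "\<And>x. x \<in> vecs V \<Longrightarrow> \<xi> x = \<eta> x"
  shows "\<xi> = \<eta>"
proof
  show "\<xi> x = \<eta> x" for x
    using assms dualD(3)[OF assms(1)] dualD(3)[OF assms(2)] by (cases "x \<in> vecs V") auto
qed

lemma dual_diff:
  assumes "\<xi> \<in> vecs (dual V)" "x \<in> vecs V" "y \<in> vecs V"
  shows "\<xi> (x - y) = \<xi> x - \<xi> y"
  using dualD(1)[OF assms(1), of "x - y" y] assms vecs_closed by simp

text \<open>The coordinate functionals of a basis already separate vectors.\<close>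

lemma vecs_eqI:
  assumes "x \<in> vecs V" "y \<in> vecs V" "\<And>\<xi>. \<xi> \<in> vecs (dual V) \<Longrightarrow> \<xi> x = \<xi> y"
  shows "x = y"
proof -
  obtain B c where B: "\<And>b. b \<in> B \<Longrightarrow> c b \<in> vecs (dual V)"
    "\<And>x. x \<in> vecs V \<Longrightarrow> x = (\<Sum>b\<in>B. smul V (c b x) b)"
    by (rule dual_basis) blast
  have "x = (\<Sum>b\<in>B. smul V (c b x) b)" using B(2) assms(1) .
  also have "\<dots> = (\<Sum>b\<in>B. smul V (c b y) b)" using assms(3)[OF B(1)] by simp
  also have "\<dots> = y" using B(2)[OF assms(2)] by simp
  finally show ?thesis .
qed

lemma dual_sum:
  assumes "\<xi> \<in> vecs (dual V)" "\<And>i. i \<in> I \<Longrightarrow> g i \<in> vecs V"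
  shows "\<xi> (\<Sum>i\<in>I. smul V (a i) (g i)) = (\<Sum>i\<in>I. a i * \<xi> (g i))"
  using linear_on_sum[OF dual_linear_on[OF assms(1)] vector_space_scalars assms(2), of I]
  by (simp add: scalars_def)

lemma dual_expansion:
  assumes B: "B \<subseteq> vecs V" "\<And>x. x \<in> vecs V \<Longrightarrow> x = (\<Sum>b\<in>B. smul V (c b x) b)"
    and \<xi>: "\<xi> \<in> vecs (dual V)" and x: "x \<in> vecs V"
  shows "\<xi> x = (\<Sum>b\<in>B. \<xi> b * c b x)"
proof -
  have "\<xi> x = \<xi> (\<Sum>b\<in>B. smul V (c b x) b)" using B(2)[OF x] by simp
  also have "\<dots> = (\<Sum>b\<in>B. c b x * \<xi> b)" using B(1) by (intro dual_sum[OF \<xi>]) auto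
  finally show ?thesis by (simp add: mult.commute)
qed

text \<open>The coordinate functionals span the dual. With this instance every result on spaces
  applies again to the dual, in particular for the bidual and for tensors over the dual.\<close>

lemma fin_dim_space_dual: "fin_dim_space (dual V)"
proof (rule fin_dim_space.intro)
  obtain B c where B: "finite B" "B \<subseteq> vecs V" "\<And>b. b \<in> B \<Longrightarrow> c b \<in> vecs (dual V)"
    "\<And>x. x \<in> vecs V \<Longrightarrow> x = (\<Sum>b\<in>B. smul V (c b x) b)"
    by (rule dual_basis) blast
  show "vector_space (smul (dual V))" by (simp add: vector_space_fun_smul)
  show sub: "module.subspace (smul (dual V)) (vecs (dual V))"
    by (auto simp: fs.subspace_def dual_def linear_on_def scalars_def fun_smul_def algebra_simps)
  have "\<xi> \<in> fs.span (c ` B)" if \<xi>: "\<xi> \<in> vecs (dual V)" for \<xi>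
  proof -
    have "\<xi> = (\<Sum>b\<in>B. fun_smul (\<xi> b) (c b))"
    proof (rule dual_eqI[OF \<xi>])
      show "(\<Sum>b\<in>B. fun_smul (\<xi> b) (c b)) \<in> vecs (dual V)"
        using sub B(3) by (auto intro!: fs.subspace_sum fs.subspace_scale)
      fix x assume x: "x \<in> vecs V"
      show "\<xi> x = (\<Sum>b\<in>B. fun_smul (\<xi> b) (c b)) x"
        using dual_expansion[OF B(2,4) \<xi> x] by (simp add: sum_apply fun_smul_apply)
    qed
    then show ?thesis
      by (metis (no_types, lifting) fs.span_base fs.span_scale fs.span_sum imageI)
  qed
  moreover have "fs.span (c ` B) \<subseteq> vecs (dual V)"
    using sub B(3) by (intro fs.span_minimal) auto
  ultimately show "\<exists>B. finite B \<and> vecs (dual V) = module.span (smul (dual V)) B"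
    using B(1) by (intro exI[of _ "c ` B"]) auto
qed

lemma bidual_ev_in_bidual: "x \<in> vecs V \<Longrightarrow> bidual_ev V x \<in> vecs (dual (dual V))"
proof -
  interpret D: fin_dim_space "dual V" by (rule fin_dim_space_dual)
  show "x \<in> vecs V \<Longrightarrow> bidual_ev V x \<in> vecs (dual (dual V))"
    using D.vecs_closed
    by (auto simp: bidual_ev_def dual_def[of "dual V"] linear_on_def scalars_def fun_smul_def)
qed

lemma bidual_ev_surj:
  assumes F: "F \<in> vecs (dual (dual V))"
  obtains x where "x \<in> vecs V" "F = bidual_ev V x"
proof -
  interpret D: fin_dim_space "dual V" by (rule fin_dim_space_dual)
  obtain B c where B: "finite B" "B \<subseteq> vecs V" "\<And>b. b \<in> B \<Longrightarrow> c b \<in> vecs (dual V)"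
    "\<And>x. x \<in> vecs V \<Longrightarrow> x = (\<Sum>b\<in>B. smul V (c b x) b)"
    by (rule dual_basis) blast
  \<comment> \<open>An evaluation at a vector is determined by the coordinates of the vector, and
    \<open>F (c b)\<close> is the coordinate that \<open>F\<close> prescribes at
    \<open>b\<close>.\<close>
  let ?x = "\<Sum>b\<in>B. smul V (F (c b)) b"
  have x: "?x \<in> vecs V" using B(2) by (auto intro!: vecs_closed)
  have "F = bidual_ev V ?x"
  proof (rule D.dual_eqI[OF F bidual_ev_in_bidual[OF x]])
    fix \<xi> assume \<xi>: "\<xi> \<in> vecs (dual V)"
    have "\<xi> = (\<Sum>b\<in>B. smul (dual V) (\<xi> b) (c b))"
    proof (rule dual_eqI[OF \<xi>])
      show "(\<Sum>b\<in>B. smul (dual V) (\<xi> b) (c b)) \<in> vecs (dual V)"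
        by (intro D.vecs_closed B)
      fix x assume x: "x \<in> vecs V"
      show "\<xi> x = (\<Sum>b\<in>B. smul (dual V) (\<xi> b) (c b)) x"
        using dual_expansion[OF B(2,4) \<xi> x] by (simp add: sum_apply fun_smul_apply)
    qed
    then have "F \<xi> = F (\<Sum>b\<in>B. smul (dual V) (\<xi> b) (c b))" by simp
    also have "\<dots> = (\<Sum>b\<in>B. \<xi> b * F (c b))"
      by (rule D.dual_sum[OF F B(3)])
    also have "\<dots> = \<xi> ?x"
      using B(2) by (subst dual_sum[OF \<xi>]) (auto simp: mult.commute)
    finally show "F \<xi> = bidual_ev V ?x \<xi>" using \<xi> by (simp add: bidual_ev_def)
  qed
  with x show ?thesis by (rule that)
qed

text \<open>This brings operators transposed to the bidual back to vectors of
  \<open>V\<close>.\<close>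

lemma transp_bidual_ev:
  assumes "\<And>\<zeta>. \<zeta> \<in> vecs (dual V) \<Longrightarrow> f \<zeta> \<in> vecs (dual V) \<and> f \<zeta> x = \<zeta> z"
  shows "transp (dual V) f (bidual_ev V x) = bidual_ev V z"
  using assms by (auto simp: transp_def bidual_ev_def fun_eq_iff)

text \<open>By reflexivity all functionals on the dual are evaluations, and at all other arguments
  both tensors vanish.\<close>

lemma tensor_dual_eqI:
  assumes S: "S \<in> vecs (tensor (dual V) (dual V))" and T: "T \<in> vecs (tensor (dual V) (dual V))"
    and eq: "\<And>x y. x \<in> vecs V \<Longrightarrow> y \<in> vecs V \<Longrightarrow>
      S (bidual_ev V x, bidual_ev V y) = T (bidual_ev V x, bidual_ev V y)"
  shows "S = T"
proof (intro ext, clarify)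
  fix F G
  show "S (F, G) = T (F, G)"
  proof (cases "F \<in> vecs (dual (dual V)) \<and> G \<in> vecs (dual (dual V))")
    case True
    then show ?thesis using eq bidual_ev_surj by metis
  next
    case False
    then show ?thesis using tensor_outside S T by metis
  qed
qed

lemma bilinear_form_sum:
  assumes b: "bilinear_on V V scalars b"
    and xy: "\<And>i. i \<in> I \<Longrightarrow> x i \<in> vecs V" "\<And>j. j \<in> J \<Longrightarrow> y j \<in> vecs V"
  shows "b (\<Sum>i\<in>I. smul V (s i) (x i)) (\<Sum>j\<in>J. smul V (t j) (y j)) =
    (\<Sum>i\<in>I. \<Sum>j\<in>J. s i * t j * b (x i) (y j))"
proof -
  let ?y = "\<Sum>j\<in>J. smul V (t j) (y j)"
  have y: "?y \<in> vecs V" using xy(2) by (auto intro!: vecs_closed)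
  have "linear_on V scalars (\<lambda>u. b u ?y)" using b y by (simp add: bilinear_on_def)
  from linear_on_sum[OF this vector_space_scalars xy(1), where a = s]
  have "b (\<Sum>i\<in>I. smul V (s i) (x i)) ?y = (\<Sum>i\<in>I. s i * b (x i) ?y)"
    by (simp add: scalars_def)
  also have "\<dots> = (\<Sum>i\<in>I. \<Sum>j\<in>J. s i * t j * b (x i) (y j))"
  proof (rule sum.cong[OF refl])
    fix i assume i: "i \<in> I"
    have "linear_on V scalars (b (x i))" using b xy(1)[OF i] by (simp add: bilinear_on_def)
    from linear_on_sum[OF this vector_space_scalars xy(2), where a = t]
    show "s i * b (x i) ?y = (\<Sum>j\<in>J. s i * t j * b (x i) (y j))"
      by (simp add: scalars_def sum_distrib_left mult.assoc)
  qed
  finally show ?thesis .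
qed

end

section \<open>The Hom-s-matrix as a self-adjoint map from the dual to the algebra\<close>

lemma s_bracket_pairing:
  assumes "fin_dim_space A" "s_bracket A m \<alpha> n x y = 0"
    and D: "\<xi> \<in> vecs (dual A)" "\<eta> \<in> vecs (dual A)" "\<zeta> \<in> vecs (dual A)"
    and xy: "\<And>i. i < n \<Longrightarrow> x i \<in> vecs A \<and> y i \<in> vecs A"
    and \<alpha>: "\<And>u. u \<in> vecs A \<Longrightarrow> \<alpha> u \<in> vecs A"
    and m: "\<And>u v. u \<in> vecs A \<Longrightarrow> v \<in> vecs A \<Longrightarrow> m u v \<in> vecs A"
  shows "(\<Sum>i<n. \<Sum>j<n. \<xi> (\<alpha> (x i)) * \<eta> (commutator m (y i) (x j)) * \<zeta> (\<alpha> (y j))) -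
    (\<Sum>i<n. \<Sum>j<n. \<xi> (m (x i) (x j)) * \<eta> (\<alpha> (y j)) * \<zeta> (\<alpha> (y i))) +
    (\<Sum>i<n. \<Sum>j<n. \<xi> (\<alpha> (x i)) * \<eta> (\<alpha> (x j)) * \<zeta> (m (y i) (y j))) = 0"
proof -
  interpret fin_dim_space A by fact
  \<comment> \<open>The third tensor power is nested to the left, so its first argument is a
    functional on \<open>tensor A A\<close>. Here it is evaluation at
    \<open>(\<xi>, \<eta>)\<close>, set to 0 off the tensors as \<open>dual\<close> demands.\<close>
  define \<Theta> where "\<Theta> T = (if T \<in> vecs (tensor A A) then T (\<xi>, \<eta>) else 0)" for T
  have "\<Theta> \<in> vecs (dual (tensor A A))"
    using subspace_tensor[of A A]
    by (auto simp: dual_def[of "tensor A A"] linear_on_def scalars_def \<Theta>_def fun_smul_def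
        fs.subspace_def)
  then have p: "ptens3 A u v w (\<Theta>, \<zeta>) = \<xi> u * \<eta> v * \<zeta> w" if "u \<in> vecs A" "v \<in> vecs A" for u v w
    using that D by (simp add: ptens3_def ptens_def[of "tensor A A"] \<Theta>_def ptens_in_tensor)
      (simp add: ptens_def)
  have "commutator m u v \<in> vecs A" if "u \<in> vecs A" "v \<in> vecs A" for u v
    using m that by (simp add: commutator_def vecs_closed)
  then have "s_bracket A m \<alpha> n x y (\<Theta>, \<zeta>) = (\<Sum>i<n. \<Sum>j<n.
      \<xi> (\<alpha> (x i)) * \<eta> (commutator m (y i) (x j)) * \<zeta> (\<alpha> (y j)) -
      \<xi> (m (x i) (x j)) * \<eta> (\<alpha> (y j)) * \<zeta> (\<alpha> (y i)) +
      \<xi> (\<alpha> (x i)) * \<eta> (\<alpha> (x j)) * \<zeta> (m (y i) (y j)))"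
    using xy \<alpha> m by (auto simp: s_bracket_def sum_apply p intro!: sum.cong)
  then show ?thesis using assms(2) by (simp add: sum.distrib sum_subtractf)
qed

locale hom_s_matrix_pre_lie = regular_hom_pre_lie A m \<alpha>
  for A :: "('k::field, 'a::ab_group_add) vspace" and m \<alpha> +
  fixes r
  assumes s_matrix: "hom_s_matrix A m \<alpha> r"
begin

abbreviation a where "a \<equiv> twist_inv A \<alpha>"
abbreviation R where "R \<equiv> sharp A r"
abbreviation D where "D \<equiv> vecs (dual A)"

sublocale D: fin_dim_space "dual A" by (rule fin_dim_space_dual)

lemmas D_closed = D.vecs_closed(2,4) D.vecs_closed(3)[simplified]

lemma \<alpha>_closed [simp]: "x \<in> vecs A \<Longrightarrow> \<alpha> x \<in> vecs A"
  using linear_onD(1)[OF twist_linear] .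

lemma m_closed [simp]: "x \<in> vecs A \<Longrightarrow> y \<in> vecs A \<Longrightarrow> m x y \<in> vecs A"
  using mult_bilinear by (auto simp: bilinear_on_def linear_on_def)

lemma a_closed [simp]: "x \<in> vecs A \<Longrightarrow> a x \<in> vecs A"
  using twist_bij by (auto simp: twist_inv_def bij_betw_def inv_into_into)

lemma \<alpha>_a [simp]: "x \<in> vecs A \<Longrightarrow> \<alpha> (a x) = x"
  using twist_bij by (auto simp: twist_inv_def bij_betw_def f_inv_into_f)

lemma a_\<alpha> [simp]: "x \<in> vecs A \<Longrightarrow> a (\<alpha> x) = x"
  using twist_bij by (auto simp: twist_inv_def bij_betw_def)

lemma a_eqI: "x \<in> vecs A \<Longrightarrow> \<alpha> x = y \<Longrightarrow> a y = x"
  by auto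

lemma vecs_diff [simp]: "x \<in> vecs A \<Longrightarrow> y \<in> vecs A \<Longrightarrow> x - y \<in> vecs A"
  and vecs_add [simp]: "x \<in> vecs A \<Longrightarrow> y \<in> vecs A \<Longrightarrow> x + y \<in> vecs A"
  and vecs_smul [simp]: "x \<in> vecs A \<Longrightarrow> smul A c x \<in> vecs A"
  by (fact vecs_closed)+

lemma linear_on_diff:
  assumes f: "linear_on A A f" and "x \<in> vecs A" "y \<in> vecs A"
  shows "f (x - y) = f x - f y"
  using linear_onD(2)[OF f, of "x - y" y] assms(2,3) by simp

lemma a_linear: "linear_on A A a"
  by (auto simp: linear_on_def linear_onD[OF twist_linear] intro!: a_eqI)

lemma m_linear: "x \<in> vecs A \<Longrightarrow> linear_on A A (m x)" "y \<in> vecs A \<Longrightarrow> linear_on A A (\<lambda>x. m x y)"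
  using mult_bilinear by (auto simp: bilinear_on_def)

lemma commutator_linear:
  "x \<in> vecs A \<Longrightarrow> linear_on A A (commutator m x)"
  "y \<in> vecs A \<Longrightarrow> linear_on A A (\<lambda>x. commutator m x y)"
proof -
  interpret vs: vector_space "smul A" by (rule vector_space_smul)
  show "x \<in> vecs A \<Longrightarrow> linear_on A A (commutator m x)"
    "y \<in> vecs A \<Longrightarrow> linear_on A A (\<lambda>x. commutator m x y)"
    using linear_onD[OF m_linear(1)] linear_onD[OF m_linear(2)]
    by (auto simp: linear_on_def commutator_def vs.scale_right_diff_distrib)
qed

lemma a_m: "x \<in> vecs A \<Longrightarrow> y \<in> vecs A \<Longrightarrow> a (m x y) = m (a x) (a y)"
  by (rule a_eqI) (simp_all add: twist_mult)

text \<open>These rules turn the identities below into linear relations between values of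
  functionals on iterated products.\<close>

lemmas expand =
  linear_on_diff[OF twist_linear]
  linear_on_diff[OF m_linear(1)] linear_on_diff[OF m_linear(2)]
  linear_onD(2)[OF m_linear(2)]
  twist_mult a_m dual_diff dualD(1)

lemma transp_D [simp]: "linear_on A A f \<Longrightarrow> \<xi> \<in> D \<Longrightarrow> transp A f \<xi> \<in> D"
  by (rule transp_in_dual)

lemma transp_twist_D [simp]:
  assumes "\<xi> \<in> D"
  shows "transp A \<alpha> \<xi> \<in> D" "transp A a \<xi> \<in> D"
    "x \<in> vecs A \<Longrightarrow> transp A (m x) \<xi> \<in> D" "x \<in> vecs A \<Longrightarrow> transp A (\<lambda>u. m u x) \<xi> \<in> D"
    "x \<in> vecs A \<Longrightarrow> transp A (commutator m x) \<xi> \<in> D"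
  using assms twist_linear a_linear m_linear commutator_linear by auto

text \<open>The Hom-pre-Lie identity solved for a single term, so that chosen instances act as
  rewrite rules.\<close>

lemma pre_lie_pairing:
  assumes "\<xi> \<in> D" "x \<in> vecs A" "y \<in> vecs A" "z \<in> vecs A"
  shows "\<xi> (m (m x y) (\<alpha> z)) =
    \<xi> (m (\<alpha> x) (m y z)) + \<xi> (m (m y x) (\<alpha> z)) - \<xi> (m (\<alpha> y) (m x z))"
proof -
  have "\<xi> (m (m x y) (\<alpha> z) - m (\<alpha> x) (m y z)) = \<xi> (m (m y x) (\<alpha> z) - m (\<alpha> y) (m x z))"
    using hom_pre_lie_identity assms by metis
  then show ?thesis using assms by (simp add: dual_diff algebra_simps)
qed

text \<open>Symmetry of \<open>r\<close> yields the second decomposition, with the factors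
  exchanged. The first is the one for which the definition supplies the vanishing bracket.\<close>

lemma r_decomposition:
  obtains n x y where "\<And>i. i < (n::nat) \<Longrightarrow> x i \<in> vecs A \<and> y i \<in> vecs A"
    "r = (\<Sum>i<n. ptens A A (x i) (y i))" "r = (\<Sum>i<n. ptens A A (y i) (x i))"
    "s_bracket A m \<alpha> n x y = 0"
proof -
  obtain n x y where *: "\<forall>i<(n::nat). x i \<in> vecs A \<and> y i \<in> vecs A"
    "r = (\<Sum>i<n. ptens A A (x i) (y i))" "s_bracket A m \<alpha> n x y = 0"
    using s_matrix by (auto simp: hom_s_matrix_def)
  have "r = flip r" using s_matrix by (simp add: hom_s_matrix_def)
  also have "\<dots> = (\<Sum>i<n. flip (ptens A A (x i) (y i)))"
    by (auto simp: *(2) flip_def fun_eq_iff sum_apply)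
  finally have "r = (\<Sum>i<n. ptens A A (y i) (x i))" by (simp add: flip_ptens)
  with * show ?thesis by (intro that[of n x y]) auto
qed

lemma r_tensor: "r \<in> vecs (tensor A A)"
  using s_matrix by (simp add: hom_s_matrix_def)

lemma R_closed [simp]: "\<xi> \<in> D \<Longrightarrow> R \<xi> \<in> vecs A"
  and R_pairing: "\<xi> \<in> D \<Longrightarrow> \<eta> \<in> D \<Longrightarrow> r (\<xi>, \<eta>) = \<eta> (R \<xi>)"
proof -
  obtain n x y where *: "\<And>i. i < (n::nat) \<Longrightarrow> x i \<in> vecs A \<and> y i \<in> vecs A"
    "r = (\<Sum>i<n. ptens A A (x i) (y i))" by (rule r_decomposition) blast
  have R: "R \<xi> = (\<Sum>i<n. smul A (\<xi> (x i)) (y i))" if "\<xi> \<in> D" for \<xi>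
    unfolding *(2) using sharp_sum_ptens[OF fin_dim_space_axioms *(1) that] by simp
  show "\<xi> \<in> D \<Longrightarrow> R \<xi> \<in> vecs A" using *(1) by (auto simp: R intro!: vecs_closed)
  show "\<xi> \<in> D \<Longrightarrow> \<eta> \<in> D \<Longrightarrow> r (\<xi>, \<eta>) = \<eta> (R \<xi>)"
    using dual_sum[of \<eta> "{..<n}" y] *(1) by (simp add: R) (simp add: *(2) sum_apply ptens_def)
qed

text \<open>Self-adjointness of \<open>R\<close>, the form in which the symmetry of \<open>r\<close>
  is used from here on.\<close>

lemma R_sym:
  assumes "\<xi> \<in> D" "\<eta> \<in> D"
  shows "\<eta> (R \<xi>) = \<xi> (R \<eta>)"
proof -
  have "flip r (\<xi>, \<eta>) = r (\<xi>, \<eta>)" using s_matrix by (simp add: hom_s_matrix_def)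
  then show ?thesis using assms by (simp add: flip_def R_pairing)
qed

lemma R_a [simp]: "\<xi> \<in> D \<Longrightarrow> R (transp A a \<xi>) = \<alpha> (R \<xi>)"
  using s_matrix by (simp add: hom_s_matrix_def)

lemma transp_cancel [simp]:
  assumes "\<xi> \<in> D"
  shows "transp A a (transp A \<alpha> \<xi>) = \<xi>" "transp A \<alpha> (transp A a \<xi>) = \<xi>"
  using assms by (auto intro!: dual_eqI)

lemma R_\<alpha> [simp]: "\<xi> \<in> D \<Longrightarrow> R (transp A \<alpha> \<xi>) = a (R \<xi>)"
  using R_a[of "transp A \<alpha> \<xi>"] by simp

text \<open>Pairing the bracket with three functionals contracts each factor of \<open>r\<close>
  into a value of \<open>R\<close>. Compatibility with the twist turns the \<alpha> inside a
  functional into \<open>a\<close> applied to that value.\<close>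

lemma s_equation:
  assumes D: "\<xi> \<in> D" "\<eta> \<in> D" "\<zeta> \<in> D"
  shows "\<eta> (commutator m (a (R \<xi>)) (a (R \<zeta>))) - \<xi> (m (a (R \<zeta>)) (a (R \<eta>)))
    + \<zeta> (m (a (R \<xi>)) (a (R \<eta>))) = 0"
proof -
  obtain n x y where *: "\<And>i. i < (n::nat) \<Longrightarrow> x i \<in> vecs A \<and> y i \<in> vecs A"
    "r = (\<Sum>i<n. ptens A A (x i) (y i))" "r = (\<Sum>i<n. ptens A A (y i) (x i))"
    "s_bracket A m \<alpha> n x y = 0" by (rule r_decomposition) blast
  \<comment> \<open>Two expansions, because the bracket feeds a functional sometimes with an
    \<open>x i\<close> and sometimes with a \<open>y i\<close>; symmetry makes both sums
    equal.\<close>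
  have aR: "a (R \<xi>) = (\<Sum>i<n. smul A (\<xi> (\<alpha> (x i))) (y i))"
    "a (R \<xi>) = (\<Sum>i<n. smul A (\<xi> (\<alpha> (y i))) (x i))" if "\<xi> \<in> D" for \<xi>
  proof -
    have "a (R \<xi>) = (\<Sum>i<n. smul A (transp A \<alpha> \<xi> (x i)) (y i))"
      using sharp_sum_ptens[OF fin_dim_space_axioms, of n x y "transp A \<alpha> \<xi>", folded *(2)] *(1) that
      by simp
    then show "a (R \<xi>) = (\<Sum>i<n. smul A (\<xi> (\<alpha> (x i))) (y i))" using *(1) by simp
    have "a (R \<xi>) = (\<Sum>i<n. smul A (transp A \<alpha> \<xi> (y i)) (x i))"
      using sharp_sum_ptens[OF fin_dim_space_axioms, of n y x "transp A \<alpha> \<xi>", folded *(3)] *(1) that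
      by simp
    then show "a (R \<xi>) = (\<Sum>i<n. smul A (\<xi> (\<alpha> (y i))) (x i))" using *(1) by simp
  qed
  have bm: "bilinear_on A A scalars (\<lambda>u v. \<xi> (m u v))"
    and bc: "bilinear_on A A scalars (\<lambda>u v. \<xi> (commutator m u v))" if "\<xi> \<in> D" for \<xi>
    using that linear_onD[OF m_linear(1)] linear_onD[OF m_linear(2)]
      linear_onD[OF commutator_linear(1)] linear_onD[OF commutator_linear(2)]
    by (auto simp: bilinear_on_def linear_on_def dualD scalars_def)
  have "\<eta> (commutator m (a (R \<xi>)) (a (R \<zeta>))) =
      (\<Sum>i<n. \<Sum>j<n. \<xi> (\<alpha> (x i)) * \<zeta> (\<alpha> (y j)) * \<eta> (commutator m (y i) (x j)))"
    unfolding aR(1)[OF D(1)] aR(2)[OF D(3)] by (intro bilinear_form_sum bc D) (auto simp: *(1))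
  moreover have "\<xi> (m (a (R \<zeta>)) (a (R \<eta>))) =
      (\<Sum>i<n. \<Sum>j<n. \<zeta> (\<alpha> (y i)) * \<eta> (\<alpha> (y j)) * \<xi> (m (x i) (x j)))"
    unfolding aR(2)[OF D(3)] aR(2)[OF D(2)] by (intro bilinear_form_sum bm D) (auto simp: *(1))
  moreover have "\<zeta> (m (a (R \<xi>)) (a (R \<eta>))) =
      (\<Sum>i<n. \<Sum>j<n. \<xi> (\<alpha> (x i)) * \<eta> (\<alpha> (x j)) * \<zeta> (m (y i) (y j)))"
    unfolding aR(1)[OF D(1)] aR(1)[OF D(2)] by (intro bilinear_form_sum bm D) (auto simp: *(1))
  ultimately show ?thesis
    using s_bracket_pairing[OF fin_dim_space_axioms *(4) D *(1)] by (simp add: mult_ac)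
qed

end

section \<open>The Hom-pre-Lie algebra on the dual space\<close>

locale hom_s_matrix_dual = hom_s_matrix_pre_lie A m \<alpha> r
  for A :: "('k::field, 'a::ab_group_add) vspace" and m \<alpha> r +
  fixes \<phi> circ
  assumes \<phi>: "\<And>x. x \<in> vecs A \<Longrightarrow> \<phi> x = L_ad A m \<alpha> (twist_inv A \<alpha> \<circ> twist_inv A \<alpha>) x r"
    and dual_prod: "dual_product A \<phi> circ"
begin

lemma circ_closed [simp]: "\<xi> \<in> D \<Longrightarrow> \<eta> \<in> D \<Longrightarrow> circ \<xi> \<eta> \<in> D"
  using dual_prod by (simp add: dual_product_def)

lemma \<phi>_circ: "\<xi> \<in> D \<Longrightarrow> \<eta> \<in> D \<Longrightarrow> x \<in> vecs A \<Longrightarrow> \<phi> x (\<xi>, \<eta>) = circ \<xi> \<eta> x"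
  using dual_prod by (simp add: dual_product_def)

lemma circ_r:
  assumes "\<xi> \<in> D" "\<eta> \<in> D" "x \<in> vecs A"
  shows "circ \<xi> \<eta> x = r (transp A (m (a (a x))) \<xi>, transp A \<alpha> \<eta>) +
    r (transp A \<alpha> \<xi>, transp A (commutator m (a (a x))) \<eta>)"
  using \<phi>_circ[OF assms] \<phi>[OF assms(3)] assms(1,2) by (simp add: L_ad_def tens_map_def)

text \<open>In the first summand of \<open>circ_r\<close>, self-adjointness moves \<open>R\<close>
  from the translated \<xi> to \<eta>; in the second it already acts on \<xi>.\<close>

lemma circ_eval:
  assumes "\<xi> \<in> D" "\<eta> \<in> D" "x \<in> vecs A"
  shows "circ \<xi> \<eta> x = \<xi> (m (a (a x)) (a (R \<eta>))) + \<eta> (commutator m (a (a x)) (a (R \<xi>)))"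
proof -
  have "r (transp A (m (a (a x))) \<xi>, transp A \<alpha> \<eta>) =
      transp A (m (a (a x))) \<xi> (R (transp A \<alpha> \<eta>))"
    using assms by (simp only: R_pairing R_sym transp_twist_D a_closed)
  then show ?thesis
    using assms by (simp add: circ_r R_pairing)
qed

text \<open>\<open>R\<close> is multiplicative: tested against \<zeta> and moved across by
  \<open>R_sym\<close>, the claim becomes \<open>s_equation\<close>.\<close>

lemma R_circ:
  assumes D: "\<xi> \<in> D" "\<eta> \<in> D"
  shows "R (circ \<xi> \<eta>) = m (R \<xi>) (R \<eta>)"
proof (rule vecs_eqI)
  fix \<zeta> assume \<zeta>: "\<zeta> \<in> D"
  \<comment> \<open>Chosen so that \<open>R ?\<zeta> = a (R \<zeta>)\<close>, which supplies the
    extra inverse twist coming from \<open>circ_eval\<close>.\<close>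
  let ?\<zeta> = "transp A \<alpha> \<zeta>"
  have "\<zeta> (R (circ \<xi> \<eta>)) = circ \<xi> \<eta> (R \<zeta>)" using R_sym D \<zeta> by simp
  also have "\<dots> = \<xi> (m (a (R ?\<zeta>)) (a (R \<eta>))) - \<eta> (commutator m (a (R \<xi>)) (a (R ?\<zeta>)))"
    using D \<zeta> by (simp add: circ_eval commutator_def dual_diff)
  also have "\<dots> = ?\<zeta> (m (a (R \<xi>)) (a (R \<eta>)))"
    using s_equation[OF D, of ?\<zeta>] \<zeta> by (simp add: algebra_simps)
  also have "\<dots> = \<zeta> (m (R \<xi>) (R \<eta>))" using D \<zeta> by (simp add: twist_mult)
  finally show "\<zeta> (R (circ \<xi> \<eta>)) = \<zeta> (m (R \<xi>) (R \<eta>))" .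
qed (use D in simp_all)

text \<open>Self-adjointness moves \<open>R\<close> off the sum, leaving pointwise addition of
  functionals; scalars are treated in the same way.\<close>

lemma R_add: "\<xi> \<in> D \<Longrightarrow> \<eta> \<in> D \<Longrightarrow> R (\<xi> + \<eta>) = R \<xi> + R \<eta>"
  by (rule vecs_eqI) (simp_all add: D_closed R_sym[of "\<xi> + \<eta>"] R_sym[of \<xi>] R_sym[of \<eta>] dualD(1))

lemma R_smul: "\<xi> \<in> D \<Longrightarrow> R (fun_smul c \<xi>) = smul A c (R \<xi>)"
  by (rule vecs_eqI)
    (simp_all add: D_closed R_sym[of "fun_smul c \<xi>"] R_sym[of \<xi>] dualD(2) fun_smul_apply)

lemma circ_bilinear: "bilinear_on (dual A) (dual A) (dual A) circ"
  unfolding bilinear_on_def linear_on_def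
  by (auto intro!: dual_eqI simp: D_closed circ_eval R_add R_smul linear_onD[OF a_linear]
      linear_onD[OF m_linear(1)] linear_onD[OF commutator_linear(1)] dualD
      fun_smul_apply algebra_simps)

lemma a_twist_circ:
  assumes "\<xi> \<in> D" "\<eta> \<in> D"
  shows "transp A a (circ \<xi> \<eta>) = circ (transp A a \<xi>) (transp A a \<eta>)"
  using assms by (intro dual_eqI) (simp_all add: circ_eval commutator_def expand)

lemma circ_hom_pre_lie_identity:
  assumes D: "\<xi> \<in> D" "\<eta> \<in> D" "\<zeta> \<in> D"
  shows "circ (circ \<xi> \<eta>) (transp A a \<zeta>) - circ (transp A a \<xi>) (circ \<eta> \<zeta>) =
    circ (circ \<eta> \<xi>) (transp A a \<zeta>) - circ (transp A a \<eta>) (circ \<xi> \<zeta>)"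
proof (rule dual_eqI)
  fix x assume x: "x \<in> vecs A"
  \<comment> \<open>Two nested products on the dual apply up to four inverse twists to
    \<open>x\<close>. Writing \<open>x\<close> and the values of \<open>R\<close> as powers of
    \<alpha> makes all inverses cancel.\<close>
  define u where "u = a (a (a (a x)))"
  have u: "u \<in> vecs A" and xu: "x = \<alpha> (\<alpha> (\<alpha> (\<alpha> u)))" using x by (simp_all add: u_def)
  define p q s where "p = a (a (R \<xi>))" and "q = a (a (R \<eta>))" and "s = a (a (R \<zeta>))"
  have pqs: "p \<in> vecs A" "q \<in> vecs A" "s \<in> vecs A"
    and R: "R \<xi> = \<alpha> (\<alpha> p)" "R \<eta> = \<alpha> (\<alpha> q)" "R \<zeta> = \<alpha> (\<alpha> s)"
    using D by (simp_all add: p_def q_def s_def)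
  show "(circ (circ \<xi> \<eta>) (transp A a \<zeta>) - circ (transp A a \<xi>) (circ \<eta> \<zeta>)) x =
    (circ (circ \<eta> \<xi>) (transp A a \<zeta>) - circ (transp A a \<eta>) (circ \<xi> \<zeta>)) x"
    \<comment> \<open>The \<xi> part is the identity of \<open>A\<close> at \<open>u, q, s\<close>
      and the \<eta> part the one at \<open>u, p, s\<close>. The \<zeta> part contains commutators
      and combines the triples \<open>u, p, q\<close>, then \<open>u, q, p\<close>, then
      \<open>p, q, u\<close>.\<close>
    using D u pqs pre_lie_pairing[OF D(1) u pqs(2,3)] pre_lie_pairing[OF D(2) u pqs(1,3)]
      pre_lie_pairing[OF D(3) u pqs(1,2)] pre_lie_pairing[OF D(3) u pqs(2,1)]
      pre_lie_pairing[OF D(3) pqs(1,2) u]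
    by (simp add: circ_eval R_circ R xu commutator_def expand)
qed (use D in \<open>simp_all add: D_closed\<close>)

sublocale C: hom_pre_lie "dual A" circ "transp A a"
proof
  show "bilinear_on (dual A) (dual A) (dual A) circ" by (rule circ_bilinear)
  show "linear_on (dual A) (dual A) (transp A a)"
    by (auto simp: linear_on_def fun_eq_iff fun_smul_apply) (simp_all add: transp_def fun_smul_apply)
qed (simp_all add: a_twist_circ circ_hom_pre_lie_identity)

section \<open>The cocycle condition on the algebra\<close>

lemma \<phi>_in_tensor: "x \<in> vecs A \<Longrightarrow> \<phi> x \<in> vecs (tensor A A)"
  by (simp add: \<phi>, rule L_ad_in_tensor)
    (simp_all add: fin_dim_space_axioms twist_linear m_linear commutator_linear r_tensor)

lemma \<phi>_outside: "x \<in> vecs A \<Longrightarrow> \<not> (\<xi> \<in> D \<and> \<eta> \<in> D) \<Longrightarrow> \<phi> x (\<xi>, \<eta>) = 0"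
  using tensor_outside \<phi>_in_tensor by metis

text \<open>At a pair of functionals, duality reduces linearity to that of the functional
  \<open>circ \<xi> \<eta>\<close>; elsewhere all values are 0.\<close>

lemma \<phi>_linear: "linear_on A (tensor A A) \<phi>"
proof -
  have "\<phi> (x + y) p = (\<phi> x + \<phi> y) p" "\<phi> (smul A c x) p = fun_smul c (\<phi> x) p"
    if "x \<in> vecs A" "y \<in> vecs A" for x y c p
    using that by (cases p; cases "fst p \<in> D \<and> snd p \<in> D";
        auto simp: \<phi>_outside \<phi>_circ fun_smul_apply dualD[OF circ_closed])+
  then show ?thesis by (simp add: linear_on_def \<phi>_in_tensor fun_eq_iff)
qed

lemma \<phi>_cocycle: "hom_lie_cocycle A (commutator m) \<alpha> (tensor A A) (L_ad A m \<alpha> (a \<circ> a)) \<phi>"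
  unfolding hom_lie_cocycle_def
proof (intro conjI ballI \<phi>_linear ext, clarify)
  fix x y \<xi> \<eta> assume x: "x \<in> vecs A" and y: "y \<in> vecs A"
  have [simp]: "commutator m x y \<in> vecs A" using x y by (simp add: commutator_def)
  show "\<phi> (commutator m x y) (\<xi>, \<eta>) =
    (L_ad A m \<alpha> (a \<circ> a) (\<alpha> x) (\<phi> y) - L_ad A m \<alpha> (a \<circ> a) (\<alpha> y) (\<phi> x)) (\<xi>, \<eta>)"
  proof (cases "\<xi> \<in> D \<and> \<eta> \<in> D")
    case True
    then have D: "\<xi> \<in> D" "\<eta> \<in> D" by auto
    define u v p q where "u = a (a x)" and "v = a (a y)" and "p = a (a (R \<xi>))" and "q = a (a (R \<eta>))"
    have uv: "u \<in> vecs A" "v \<in> vecs A" and xy: "x = \<alpha> (\<alpha> u)" "y = \<alpha> (\<alpha> v)"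
      using x y by (simp_all add: u_def v_def)
    have pq: "p \<in> vecs A" "q \<in> vecs A" and R: "R \<xi> = \<alpha> (\<alpha> p)" "R \<eta> = \<alpha> (\<alpha> q)"
      using D by (simp_all add: p_def q_def)
    \<comment> \<open>These are the terms with \<open>R\<close> applied to a translated functional.
      The two sides stem from opposite halves of the cocycle difference, so the instances at
      \<open>\<alpha> u, \<alpha> v\<close> and at \<open>\<alpha> v, \<alpha> u\<close> cancel all
      of them.\<close>
    have mixed: "\<xi> (m u (R (transp A (commutator m v) \<eta>))) =
        \<eta> (m v (R (transp A (m u) \<xi>))) - \<eta> (m (R (transp A (m u) \<xi>)) v)"
      if "u \<in> vecs A" "v \<in> vecs A" for u v
      using that D R_sym[of "transp A (m u) \<xi>" "transp A (commutator m v) \<eta>"]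
      by (simp add: commutator_def dual_diff)
    show ?thesis
      \<comment> \<open>What remains is, for \<xi>, the Hom-pre-Lie identity at
        \<open>u, v, q\<close> and, for \<eta>, the Hom-Jacobi identity for \<open>u, v, p\<close>,
        assembled from three Hom-pre-Lie identities.\<close>
      using D uv pq mixed[of "\<alpha> u" "\<alpha> v"] mixed[of "\<alpha> v" "\<alpha> u"]
        pre_lie_pairing[OF D(1) uv pq(2)] pre_lie_pairing[OF D(2) uv pq(1)]
        pre_lie_pairing[OF D(2) uv(1) pq(1) uv(2)] pre_lie_pairing[OF D(2) uv(2) pq(1) uv(1)]
      by (simp add: \<phi>_circ L_ad_def tens_map_def x y)
        (simp add: circ_eval R xy commutator_def expand)
  next
    case False
    then show ?thesis
      using x y by (auto simp: L_ad_def tens_map_def \<phi>_outside)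
  qed
qed

section \<open>The cocycle condition on the dual\<close>

text \<open>Both formulas read \<open>circ_eval\<close> as a function of the second factor, with
  \<open>R\<close> moved onto \<xi>. In the commutator the left multiplications by
  \<open>a (a x)\<close> cancel, which leaves only right multiplications.\<close>

lemma circ_transp_bidual_ev:
  assumes \<xi>: "\<xi> \<in> D" and x: "x \<in> vecs A"
  shows "transp (dual A) (circ \<xi>) (bidual_ev A x) =
      bidual_ev A (\<alpha> (R (transp A (m (a (a x))) \<xi>)) + commutator m (a (a x)) (a (R \<xi>)))"
    and "transp (dual A) (commutator circ \<xi>) (bidual_ev A x) =
      bidual_ev A (\<alpha> (R (transp A (\<lambda>u. m u (a (a x))) \<xi>)) - m (a (R \<xi>)) (a (a x)))"
proof -
  have sym: "\<zeta> (\<alpha> (R (transp A f \<xi>))) = \<xi> (f (a (R \<zeta>)))"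
    if "\<zeta> \<in> D" "transp A f \<xi> \<in> D" for \<zeta> f
    using that \<xi> R_sym[of "transp A f \<xi>" "transp A \<alpha> \<zeta>"] by simp
  have [simp]: "commutator m (a (a x)) (a (R \<xi>)) \<in> vecs A" using \<xi> x by (simp add: commutator_def)
  show "transp (dual A) (circ \<xi>) (bidual_ev A x) =
      bidual_ev A (\<alpha> (R (transp A (m (a (a x))) \<xi>)) + commutator m (a (a x)) (a (R \<xi>)))"
    using \<xi> x by (intro transp_bidual_ev) (simp add: circ_eval sym dualD(1))
  show "transp (dual A) (commutator circ \<xi>) (bidual_ev A x) =
      bidual_ev A (\<alpha> (R (transp A (\<lambda>u. m u (a (a x))) \<xi>)) - m (a (R \<xi>)) (a (a x)))"
    using \<xi> x by (intro transp_bidual_ev)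
      (simp add: commutator_def D_closed circ_eval sym dual_diff)
qed

lemma \<psi>_cocycle:
  assumes \<psi>: "dual_coproduct A m \<psi>"
  shows "hom_lie_cocycle (dual A) (commutator circ) (transp A a) (tensor (dual A) (dual A))
    (L_ad (dual A) circ (transp A a) (transp A (\<alpha> \<circ> \<alpha>))) \<psi>"
proof -
  have \<psi>_in: "\<psi> \<xi> \<in> vecs (tensor (dual A) (dual A))" if "\<xi> \<in> D" for \<xi>
    using \<psi> that by (simp add: dual_coproduct_def)
  have \<psi>_ev: "\<psi> \<xi> (bidual_ev A x, bidual_ev A y) = \<xi> (m x y)"
    if "\<xi> \<in> D" "x \<in> vecs A" "y \<in> vecs A" for \<xi> x y
    using \<psi> that by (simp add: dual_coproduct_def)
  have circ_lin: "linear_on (dual A) (dual A) (circ \<xi>)" "linear_on (dual A) (dual A) (\<lambda>\<eta>. circ \<eta> \<xi>)"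
    if "\<xi> \<in> D" for \<xi>
    using circ_bilinear that by (auto simp: bilinear_on_def)
  have com_lin: "linear_on (dual A) (dual A) (commutator circ \<xi>)" if "\<xi> \<in> D" for \<xi>
    using linear_onD[OF circ_lin(1)[OF that]] linear_onD[OF circ_lin(2)[OF that]] that
    by (simp add: linear_on_def commutator_def D_closed fs.scale_right_diff_distrib)
  let ?\<rho> = "L_ad (dual A) circ (transp A a) (transp A (\<alpha> \<circ> \<alpha>))"
  \<comment> \<open>The cocycle condition evaluates the representation at a twisted element; one
    factor of its inverse square cancels.\<close>
  have twist: "transp A (\<alpha> \<circ> \<alpha>) (transp A a \<xi>) = transp A \<alpha> \<xi>" for \<xi>
    by (auto simp: transp_def fun_eq_iff)
  have \<rho>_in: "?\<rho> (transp A a \<xi>) (\<psi> \<eta>) \<in> vecs (tensor (dual A) (dual A))" if "\<xi> \<in> D" "\<eta> \<in> D" for \<xi> \<eta>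
    using that by (intro L_ad_in_tensor)
      (simp_all add: D.fin_dim_space_axioms C.twist_linear circ_lin com_lin \<psi>_in twist)
  have twist_ev: "transp (dual A) (transp A a) (bidual_ev A x) = bidual_ev A (a x)"
    if "x \<in> vecs A" for x
    using that by (intro transp_bidual_ev) simp
  have \<rho>_ev: "?\<rho> (transp A a \<xi>) (\<psi> \<eta>) (bidual_ev A x, bidual_ev A y) =
      \<eta> (m (\<alpha> (R (transp A (m (a (a x))) (transp A \<alpha> \<xi>))) + commutator m (a (a x)) (a (a (R \<xi>)))) (a y))
      + \<eta> (m (a x) (\<alpha> (R (transp A (\<lambda>u. m u (a (a y))) (transp A \<alpha> \<xi>))) - m (a (a (R \<xi>))) (a (a y))))"
    if "\<xi> \<in> D" "\<eta> \<in> D" "x \<in> vecs A" "y \<in> vecs A" for \<xi> \<eta> x y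
  proof -
    have "commutator m (a (a x)) (a (a (R \<xi>))) \<in> vecs A" using that by (simp add: commutator_def)
    then show ?thesis
      using that by (simp add: L_ad_def tens_map_def bidual_ev_in_bidual twist twist_ev
          circ_transp_bidual_ev \<psi>_ev)
  qed
  \<comment> \<open>Self-adjointness again: the first summand of one half of the difference cancels
    against the second summand of the other half in the terms with a translated functional.\<close>
  have mixed: "\<theta> (m (R (transp A (m u) \<omega>)) v) = \<omega> (m u (R (transp A (\<lambda>w. m w v) \<theta>)))"
    if "\<theta> \<in> D" "\<omega> \<in> D" "u \<in> vecs A" "v \<in> vecs A" for \<theta> \<omega> u v
    using that R_sym[of "transp A (m u) \<omega>" "transp A (\<lambda>w. m w v) \<theta>"] by simp
  show ?thesis
    unfolding hom_lie_cocycle_def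
  proof (intro conjI ballI)
    show "linear_on (dual A) (tensor (dual A) (dual A)) \<psi>"
      unfolding linear_on_def
      by (auto intro!: tensor_dual_eqI fs.subspace_add[OF subspace_tensor]
          fs.subspace_scale[OF subspace_tensor] \<psi>_in simp: D_closed \<psi>_ev fun_smul_apply)
  next
    fix \<xi> \<eta> assume D: "\<xi> \<in> D" "\<eta> \<in> D"
    have com: "commutator circ \<xi> \<eta> \<in> D" using D by (simp add: commutator_def D_closed)
    show "\<psi> (commutator circ \<xi> \<eta>) = ?\<rho> (transp A a \<xi>) (\<psi> \<eta>) - ?\<rho> (transp A a \<eta>) (\<psi> \<xi>)"
    proof (rule tensor_dual_eqI)
      show "\<psi> (commutator circ \<xi> \<eta>) \<in> vecs (tensor (dual A) (dual A))" using com by (rule \<psi>_in)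
      show "?\<rho> (transp A a \<xi>) (\<psi> \<eta>) - ?\<rho> (transp A a \<eta>) (\<psi> \<xi>) \<in> vecs (tensor (dual A) (dual A))"
        by (intro fs.subspace_diff[OF subspace_tensor] \<rho>_in D)
      fix x y assume x: "x \<in> vecs A" and y: "y \<in> vecs A"
      define u v p q where "u = a (a x)" and "v = a (a y)" and "p = a (a (R \<xi>))"
        and "q = a (a (R \<eta>))"
      have uv: "u \<in> vecs A" "v \<in> vecs A" and xy: "x = \<alpha> (\<alpha> u)" "y = \<alpha> (\<alpha> v)"
        using x y by (simp_all add: u_def v_def)
      have pq: "p \<in> vecs A" "q \<in> vecs A" and R: "R \<xi> = \<alpha> (\<alpha> p)" "R \<eta> = \<alpha> (\<alpha> q)"
        using D by (simp_all add: p_def q_def)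
      let ?\<xi> = "transp A \<alpha> \<xi>" and ?\<eta> = "transp A \<alpha> \<eta>"
      show "\<psi> (commutator circ \<xi> \<eta>) (bidual_ev A x, bidual_ev A y) =
        (?\<rho> (transp A a \<xi>) (\<psi> \<eta>) - ?\<rho> (transp A a \<eta>) (\<psi> \<xi>)) (bidual_ev A x, bidual_ev A y)"
        \<comment> \<open>After cancellation the \<eta> part is the Hom-pre-Lie identity at
          \<open>u, p, v\<close> and the \<xi> part the one at \<open>u, q, v\<close>.\<close>
        using D uv pq mixed[of ?\<eta> ?\<xi> u v] mixed[of ?\<xi> ?\<eta> u v]
          pre_lie_pairing[OF D(2) uv(1) pq(1) uv(2)] pre_lie_pairing[OF D(1) uv(1) pq(2) uv(2)]
        by (simp add: \<psi>_ev[OF com x y] \<rho>_ev x y)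
          (simp add: commutator_def circ_eval R xy expand algebra_simps)
    qed
  qed
qed

section \<open>Assembly of the bialgebra\<close>

lemma bialgebra:
  assumes "dual_coproduct A m \<psi>"
  shows "hom_pre_lie_bialgebra A m \<alpha> circ \<phi> \<psi>"
  unfolding hom_pre_lie_bialgebra_def
  using regular_hom_pre_lie_axioms C.hom_pre_lie_axioms dual_prod assms \<phi>_cocycle
    \<psi>_cocycle[OF assms] by blast

end

theorem theorem4p7:
  fixes A :: "('k::field, 'a::ab_group_add) vspace"
    and m :: "'a \<Rightarrow> 'a \<Rightarrow> 'a" and \<alpha> :: "'a \<Rightarrow> 'a"
    and r :: "('a \<Rightarrow> 'k) \<times> ('a \<Rightarrow> 'k) \<Rightarrow> 'k"
    and \<phi> :: "'a \<Rightarrow> ('a \<Rightarrow> 'k) \<times> ('a \<Rightarrow> 'k) \<Rightarrow> 'k"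
    and circ :: "('a \<Rightarrow> 'k) \<Rightarrow> ('a \<Rightarrow> 'k) \<Rightarrow> 'a \<Rightarrow> 'k"
    and \<psi> :: "('a \<Rightarrow> 'k) \<Rightarrow> (('a \<Rightarrow> 'k) \<Rightarrow> 'k) \<times> (('a \<Rightarrow> 'k) \<Rightarrow> 'k) \<Rightarrow> 'k"
  assumes "regular_hom_pre_lie A m \<alpha>"
    and "hom_s_matrix A m \<alpha> r"
    and "\<And>x. x \<in> vecs A \<Longrightarrow> \<phi> x = L_ad A m \<alpha> (twist_inv A \<alpha> \<circ> twist_inv A \<alpha>) x r"
    and "dual_product A \<phi> circ"
    and "dual_coproduct A m \<psi>"
  shows "hom_pre_lie_bialgebra A m \<alpha> circ \<phi> \<psi>"
proof -
  interpret hom_s_matrix_dual A m \<alpha> r \<phi> circ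
    by (intro hom_s_matrix_dual.intro hom_s_matrix_pre_lie.intro hom_s_matrix_pre_lie_axioms.intro
        hom_s_matrix_dual_axioms.intro assms)
  show ?thesis using assms(5) by (rule bialgebra)
qed

end
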